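(* Let $\Gamma$ be a finitely generated group with a finite symmetric generating set $S$, and let $\rho\colon\Gamma\curvearrowright\mathcal H$ be an affine action on a Hilbert space, $\rho(\gamma)(\mathbf v)=A(\gamma)\mathbf v+b(\gamma)$, satisfying $\|A(\gamma)\|\le C\,l_{\mathrm{conj}}([\gamma])^\sigma$ for all $\gamma\ne e$, for some $C>0$, $\sigma\ge0$. Suppose $\rho(\Gamma)$ has no fixed point. Then there exist a Hilbert space $\mathcal H'$, an affine action $\rho'\colon\Gamma\curvearrowright\mathcal H'$ with linear parts $A'$ satisfying $\|A'(\gamma)\|\le C\,l_{\mathrm{conj}}([\gamma])^\sigma$ for all $\gamma\neq e$ (same $C,\sigma$), and a nonconstant harmonic $\rho'$-equivariant map $f\colon\Gamma\to\mathcal H'$.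
   Context: $l$ is word length w.r.t. $S$; $l_{\mathrm{conj}}(c)=\inf_{\gamma\in c}l(\gamma)$ for a conjugacy class $c$, $[\gamma]$ the class of $\gamma$. A map $f\colon\Gamma\to\mathcal H$ is $\rho$-equivariant if $f(\gamma x)=\rho(\gamma)(f(x))$ for all $\gamma,x\in\Gamma$. It is harmonic if $\frac1{\#S}\sum_{s\in S}f(xs)=f(x)$ for all $x\in\Gamma$. *)

theory Defs
  imports "HOL-Analysis.Analysis" "HOL-Algebra.Algebra"
begin

definition word_length :: "('g, 'b) monoid_scheme \<Rightarrow> 'g set \<Rightarrow> 'g \<Rightarrow> nat" where
  "word_length G S g =
     (LEAST n. \<exists>ws. length ws = n \<and> set ws \<subseteq> S \<and> foldr (\<otimes>\<^bsub>G\<^esub>) ws \<one>\<^bsub>G\<^esub> = g)"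

definition conj_length :: "('g, 'b) monoid_scheme \<Rightarrow> 'g set \<Rightarrow> 'g \<Rightarrow> nat" where
  "conj_length G S g =
     (LEAST n. \<exists>h\<in>carrier G. word_length G S (h \<otimes>\<^bsub>G\<^esub> g \<otimes>\<^bsub>G\<^esub> inv\<^bsub>G\<^esub> h) = n)"

definition l2 :: "(nat \<Rightarrow> real) set" where
  "l2 = {x. summable (\<lambda>n. (x n)\<^sup>2)}"

definition l2_norm :: "(nat \<Rightarrow> real) \<Rightarrow> real" where
  "l2_norm x = sqrt (suminf (\<lambda>n. (x n)\<^sup>2))"

definition l2_linear :: "((nat \<Rightarrow> real) \<Rightarrow> (nat \<Rightarrow> real)) \<Rightarrow> bool" where
  "l2_linear T \<longleftrightarrow> (\<forall>v\<in>l2. T v \<in> l2)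
     \<and> (\<forall>v\<in>l2. \<forall>w\<in>l2. T (\<lambda>n. v n + w n) = (\<lambda>n. T v n + T w n))
     \<and> (\<forall>c. \<forall>v\<in>l2. T (\<lambda>n. c * v n) = (\<lambda>n. c * T v n))"

definition l2_bounded :: "((nat \<Rightarrow> real) \<Rightarrow> (nat \<Rightarrow> real)) \<Rightarrow> bool" where
  "l2_bounded T \<longleftrightarrow> (\<exists>K. \<forall>v\<in>l2. l2_norm (T v) \<le> K * l2_norm v)"

definition l2_opnorm :: "((nat \<Rightarrow> real) \<Rightarrow> (nat \<Rightarrow> real)) \<Rightarrow> real" where
  "l2_opnorm T = Sup {l2_norm (T v) | v. v \<in> l2 \<and> l2_norm v \<le> 1}"

end

theory Submission
  imports Defs "HOL-Complex_Analysis.Great_Picard"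
begin

text \<open>
  For \<open>0 < r < 1\<close> replace the inner product of \<open>H\<close> by \<open>B(v,w) = \<Sum>\<^sub>k r\<^sup>k E\<langle>A(X\<^sub>k)v, A(X\<^sub>k)w\<rangle>\<close>, where \<open>X\<^sub>k\<close>
  is the random walk generated by \<open>S\<close>; the sum converges since \<open>\<parallel>A\<parallel>\<close> grows polynomially. The bound on
  \<open>\<parallel>A(\<gamma>)\<parallel>\<close> is a class function, hence it persists for \<open>B\<close> with the same constants, while the average of
  \<open>B(A(s)v,A(s)v)\<close> over \<open>S\<close> is at most \<open>B(v,v) / r\<close>. With \<open>P\<close> the average of the \<open>\<rho>(s)\<close> and
  \<open>u = Pv - v\<close>, this almost-contraction makes the lazy iteration \<open>v \<mapsto> (v + Pv)/2\<close> converge geometrically to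
  a fixed point of \<open>\<rho>\<close>, unless for some \<open>v\<close> the vector \<open>u\<close> is almost \<open>A\<close>-invariant relative to the
  displacements \<open>\<rho>(s)v - v\<close>. As there is no fixed point, such \<open>v\<close> exist for \<open>r \<rightarrow> 1\<close> with errors tending
  to \<open>0\<close>. The rescaled cocycles \<open>\<gamma> \<mapsto> \<rho>(\<gamma>)v - v\<close> have a limit (of Gram matrices) whose average over \<open>S\<close>
  is an invariant vector. Dividing by that vector leaves a harmonic cocycle, and it is nonzero because an invariant
  cocycle with values in one line is odd on the symmetric set \<open>S\<close>. An orthonormal basis of countably many copies of the
  span of the limit cocycle identifies the resulting Hilbert space with \<open>l\<^sup>2\<close> even when the span is finite-dimensional.
\<close>

section \<open>The Hilbert space of square-summable sequences\<close>

lemma l2_summable_mult: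
  assumes "x \<in> l2" "y \<in> l2"
  shows "summable (\<lambda>n. x n * y n)"
proof (rule summable_comparison_test')
  show "summable (\<lambda>n. (x n)\<^sup>2 + (y n)\<^sup>2)"
    using assms by (auto simp: l2_def intro: summable_add)
  show "norm (x n * y n) \<le> (x n)\<^sup>2 + (y n)\<^sup>2" for n
    using sum_squares_bound[of "\<bar>x n\<bar>" "\<bar>y n\<bar>"] mult_nonneg_nonneg[of "\<bar>x n\<bar>" "\<bar>y n\<bar>"]
    by (simp add: abs_mult del: mult_nonneg_nonneg)
qed

lemma l2_zero: "(\<lambda>n. 0) \<in> l2"
  by (simp add: l2_def)

lemma l2_add:
  assumes "x \<in> l2" "y \<in> l2" shows "(\<lambda>n. x n + y n) \<in> l2"
proof -
  have "summable (\<lambda>n. (x n)\<^sup>2 + (y n)\<^sup>2 + 2 * (x n * y n))"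
    using assms l2_summable_mult[OF assms] by (intro summable_add summable_mult) (auto simp: l2_def)
  then show ?thesis
    by (simp add: l2_def power2_sum mult.assoc)
qed

lemma l2_scale: "x \<in> l2 \<Longrightarrow> (\<lambda>n. c * x n) \<in> l2"
  by (simp add: l2_def power_mult_distrib summable_mult)

text \<open>A type in place of the set \<open>l2\<close> gives access to the classes of inner
  product and complete spaces. \<open>harmonic_l2_action\<close> translates back to plain
  sequences.\<close>

typedef ell2 = l2
  morphisms coord Abs_ell2
  using l2_zero by blast

setup_lifting type_definition_ell2

lemma ell2_eqI: "(\<And>n. coord x n = coord y n) \<Longrightarrow> x = y"
  by (meson coord_inject ext)

instantiation ell2 :: real_inner
begin

lift_definition zero_ell2 :: ell2 is "\<lambda>n. 0" by (rule l2_zero)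

lift_definition plus_ell2 :: "ell2 \<Rightarrow> ell2 \<Rightarrow> ell2" is "\<lambda>x y n. x n + y n" by (rule l2_add)

lift_definition scaleR_ell2 :: "real \<Rightarrow> ell2 \<Rightarrow> ell2" is "\<lambda>c x n. c * x n" by (rule l2_scale)

lift_definition uminus_ell2 :: "ell2 \<Rightarrow> ell2" is "\<lambda>x n. - x n"
  using l2_scale[of _ "-1"] by simp

lift_definition minus_ell2 :: "ell2 \<Rightarrow> ell2 \<Rightarrow> ell2" is "\<lambda>x y n. x n - y n"
  using l2_add[OF _ l2_scale[of _ "-1"]] by simp

lift_definition inner_ell2 :: "ell2 \<Rightarrow> ell2 \<Rightarrow> real" is "\<lambda>x y. suminf (\<lambda>n. x n * y n)" .

definition norm_ell2 :: "ell2 \<Rightarrow> real" where "norm_ell2 x = sqrt (inner x x)"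

definition sgn_ell2 :: "ell2 \<Rightarrow> ell2" where "sgn_ell2 x = inverse (norm x) *\<^sub>R x"

definition dist_ell2 :: "ell2 \<Rightarrow> ell2 \<Rightarrow> real" where "dist_ell2 x y = norm (x - y)"

definition uniformity_ell2 :: "(ell2 \<times> ell2) filter" where
  "uniformity_ell2 = (INF e\<in>{0<..}. principal {(x, y). dist x y < e})"

definition open_ell2 :: "ell2 set \<Rightarrow> bool" where
  "open_ell2 U = (\<forall>x\<in>U. eventually (\<lambda>(x', y). x' = x \<longrightarrow> y \<in> U) uniformity)"

instance
proof
  fix x y z :: ell2 and a b :: real
  show "x + y + z = x + (y + z)" "x + y = y + x" "0 + x = x" "- x + x = 0" "x - y = x + - y"
    "a *\<^sub>R (x + y) = a *\<^sub>R x + a *\<^sub>R y" "(a + b) *\<^sub>R x = a *\<^sub>R x + b *\<^sub>R x"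
    "a *\<^sub>R b *\<^sub>R x = (a * b) *\<^sub>R x" "1 *\<^sub>R x = x"
    by (transfer; simp add: algebra_simps)+
  show "dist x y = norm (x - y)" by (rule dist_ell2_def)
  show "sgn x = inverse (norm x) *\<^sub>R x" by (rule sgn_ell2_def)
  show "uniformity = (INF e\<in>{0<..}. principal {(x::ell2, y). dist x y < e})"
    by (rule uniformity_ell2_def)
  show "open U = (\<forall>x\<in>U. eventually (\<lambda>(x', y). x' = x \<longrightarrow> y \<in> U) uniformity)" for U :: "ell2 set"
    by (rule open_ell2_def)
  show "inner x y = inner y x"
    by transfer (simp add: mult.commute)
  show "inner (x + y) z = inner x z + inner y z"
    by transfer (simp add: ring_distribs suminf_add l2_summable_mult)
  show "inner (a *\<^sub>R x) y = a * inner x y"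
    by transfer (simp add: suminf_mult l2_summable_mult mult.assoc)
  show "0 \<le> inner x x"
    by transfer (simp add: suminf_nonneg l2_summable_mult)
  show "(inner x x = 0) = (x = 0)"
    by transfer (auto simp: suminf_eq_zero_iff l2_summable_mult fun_eq_iff)
  show "norm x = sqrt (inner x x)" by (rule norm_ell2_def)
qed

end

lemma coord_simps [simp]:
  "coord 0 n = 0" "coord (x + y) n = coord x n + coord y n" "coord (x - y) n = coord x n - coord y n"
  "coord (- x) n = - coord x n" "coord (c *\<^sub>R x) n = c * coord x n"
  by (transfer; simp)+

lemma coord_sum: "coord (sum f F) n = (\<Sum>i\<in>F. coord (f i) n)"
  by (induction F rule: infinite_finite_induct) auto

lemma l2_norm_coord: "l2_norm (coord x) = norm x"
  by (simp add: l2_norm_def norm_eq_sqrt_inner inner_ell2.rep_eq power2_eq_square)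

lemma sum_coord_le_norm: "(\<Sum>i<k. (coord x i)\<^sup>2) \<le> (norm x)\<^sup>2"
proof -
  have "summable (\<lambda>i. (coord x i)\<^sup>2)"
    using coord[of x] by (simp add: l2_def)
  then have "(\<Sum>i<k. (coord x i)\<^sup>2) \<le> suminf (\<lambda>i. (coord x i)\<^sup>2)"
    by (intro sum_le_suminf) auto
  also have "\<dots> = (norm x)\<^sup>2"
    unfolding power2_norm_eq_inner inner_ell2.rep_eq by (simp add: power2_eq_square)
  finally show ?thesis .
qed

lemma abs_coord_le_norm: "\<bar>coord x i\<bar> \<le> norm x"
proof -
  have "(coord x i)\<^sup>2 \<le> (\<Sum>i<Suc i. (coord x i)\<^sup>2)"
    by (simp add: sum_nonneg)
  also have "\<dots> \<le> (norm x)\<^sup>2" by (rule sum_coord_le_norm)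
  finally show ?thesis
    using abs_le_square_iff[of "coord x i" "norm x"] by simp
qed

text \<open>A bound on finite sections survives coordinatewise limits, and it yields
  square-summability and the norm estimate at once; completeness rests on this.\<close>

lemma ell2_of_partial_sums:
  assumes "\<And>k. (\<Sum>i<k. (a i)\<^sup>2) \<le> c\<^sup>2" "0 \<le> c"
  shows "\<exists>x. coord x = a \<and> norm x \<le> c"
proof -
  have s: "summable (\<lambda>i. (a i)\<^sup>2)"
    by (rule summableI_nonneg_bounded[OF _ assms(1)]) simp
  then have "a \<in> l2" by (simp add: l2_def)
  then have c: "coord (Abs_ell2 a) = a" by (rule Abs_ell2_inverse)
  have "(norm (Abs_ell2 a))\<^sup>2 = suminf (\<lambda>i. (a i)\<^sup>2)"
    unfolding power2_norm_eq_inner inner_ell2.rep_eq c by (simp add: power2_eq_square)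
  also have "\<dots> \<le> c\<^sup>2"
    by (rule suminf_le_const[OF s assms(1)])
  finally show ?thesis
    using c assms(2) power2_le_imp_le by blast
qed

instance ell2 :: complete_space
proof
  fix U :: "nat \<Rightarrow> ell2"
  assume U: "Cauchy U"
  have "Cauchy (\<lambda>m. coord (U m) i)" for i
  proof (rule metric_CauchyI)
    fix e :: real assume "e > 0"
    then obtain M where "\<forall>m\<ge>M. \<forall>n\<ge>M. dist (U m) (U n) < e"
      using U metric_CauchyD by blast
    moreover have "dist (coord (U m) i) (coord (U n) i) \<le> dist (U m) (U n)" for m n
      using abs_coord_le_norm[of "U m - U n" i] by (simp add: dist_norm)
    ultimately show "\<exists>M. \<forall>m\<ge>M. \<forall>n\<ge>M. dist (coord (U m) i) (coord (U n) i) < e"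
      using le_less_trans by blast
  qed
  then have "\<exists>l. (\<lambda>m. coord (U m) i) \<longlonglongrightarrow> l" for i
    using Cauchy_convergent convergent_def by blast
  then obtain a where a: "\<And>i. (\<lambda>m. coord (U m) i) \<longlonglongrightarrow> a i"
    by metis
  \<comment> \<open>Letting \<open>n\<close> tend to infinity in finite sections of
    \<open>U m - U n\<close> bounds the distance to the coordinatewise limit \<open>a\<close>,
    although \<open>a\<close> is not yet known to be square-summable.\<close>
  have close: "\<exists>d. coord d = (\<lambda>i. coord (U m) i - a i) \<and> norm d \<le> e"
    if "e > 0" and MM: "\<forall>n\<ge>M. \<forall>m\<ge>M. dist (U m) (U n) < e" and "m \<ge> M" for e m M
  proof (rule ell2_of_partial_sums)
    fix k
    have "(\<lambda>n. \<Sum>i<k. (coord (U m) i - coord (U n) i)\<^sup>2) \<longlonglongrightarrow> (\<Sum>i<k. (coord (U m) i - a i)\<^sup>2)"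
      by (intro tendsto_intros a)
    moreover have "(\<Sum>i<k. (coord (U m) i - coord (U n) i)\<^sup>2) \<le> e\<^sup>2" if "n \<ge> M" for n
    proof -
      have "(\<Sum>i<k. (coord (U m) i - coord (U n) i)\<^sup>2) \<le> (norm (U m - U n))\<^sup>2"
        using sum_coord_le_norm[of "U m - U n" k] by simp
      also have "\<dots> \<le> e\<^sup>2"
        using MM \<open>m \<ge> M\<close> that by (intro power_mono) (simp_all add: dist_norm order_less_imp_le)
      finally show ?thesis .
    qed
    ultimately show "(\<Sum>i<k. (coord (U m) i - a i)\<^sup>2) \<le> e\<^sup>2"
      by (intro LIMSEQ_le_const2) blast+
  qed (use that in simp)
  obtain M1 where "\<forall>n\<ge>M1. \<forall>m\<ge>M1. dist (U m) (U n) < 1"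
    using U metric_CauchyD[OF U, of 1] by auto
  then obtain d where d: "coord d = (\<lambda>i. coord (U M1) i - a i)"
    using close[of 1 M1 M1] by auto
  \<comment> \<open>As \<open>d\<close> is square-summable, \<open>U M1 - d\<close> is an element of
    the space with coordinates \<open>a\<close>.\<close>
  have "U \<longlonglongrightarrow> U M1 - d"
  proof (rule metric_LIMSEQ_I)
    fix e :: real assume "e > 0"
    then obtain M where M: "\<forall>n\<ge>M. \<forall>m\<ge>M. dist (U m) (U n) < e / 2"
      using metric_CauchyD[OF U, of "e / 2"] by auto
    have "dist (U m) (U M1 - d) < e" if "m \<ge> M" for m
    proof -
      have "e / 2 > 0" using \<open>e > 0\<close> by simp
      from close[OF this M \<open>m \<ge> M\<close>]
      obtain d' where d': "coord d' = (\<lambda>i. coord (U m) i - a i)" "norm d' \<le> e / 2" by blast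
      have "U m - (U M1 - d) = d'"
        by (rule ell2_eqI) (simp add: d d')
      then show ?thesis
        using d' \<open>e > 0\<close> by (simp add: dist_norm)
    qed
    then show "\<exists>M. \<forall>m\<ge>M. dist (U m) (U M1 - d) < e" by blast
  qed
  then show "convergent U" by (auto simp: convergent_def)
qed

instance ell2 :: banach ..

section \<open>Unit vectors and orthonormal expansion\<close>

lift_definition unit_vec :: "nat \<Rightarrow> ell2" is "\<lambda>k n. if n = k then 1 else 0"
proof -
  fix k :: nat
  have "summable (\<lambda>n. (if n = k then 1 else 0 :: real)\<^sup>2)"
    by (rule summable_finite[of "{k}"]) auto
  then show "(\<lambda>n. if n = k then 1 else 0) \<in> l2" by (simp add: l2_def)
qed

lemma coord_unit_vec: "coord (unit_vec k) n = (if n = k then 1 else 0)"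
  by transfer simp

lemma inner_unit_vec: "inner x (unit_vec k) = coord x k"
proof -
  have "inner x (unit_vec k) = suminf (\<lambda>n. coord x n * (if n = k then 1 else 0))"
    by (simp add: inner_ell2.rep_eq coord_unit_vec)
  also have "\<dots> = (\<Sum>n\<in>{k}. coord x n * (if n = k then 1 else 0))"
    by (rule suminf_finite) auto
  finally show ?thesis by simp
qed

lemma norm_sum_unit_vec:
  assumes "finite F"
  shows "(norm (\<Sum>k\<in>F. c k *\<^sub>R unit_vec k))\<^sup>2 = (\<Sum>k\<in>F. (c k)\<^sup>2)"
  using assms unfolding power2_norm_eq_inner inner_sum_right inner_scaleR_right inner_unit_vec
  by (simp add: coord_sum coord_unit_vec power2_eq_square if_distrib sum.delta cong: if_cong)

text \<open>The partial sums are orthogonal projections of \<open>x\<close>, so the squared error is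
  the squared norm minus a partial sum of squared coordinates.\<close>

lemma unit_vec_expansion: "(\<lambda>n. coord x n *\<^sub>R unit_vec n) sums x"
  unfolding sums_def
proof (rule metric_LIMSEQ_I)
  have s: "summable (\<lambda>n. (coord x n)\<^sup>2)" using coord[of x] by (simp add: l2_def)
  fix e :: real assume "e > 0"
  then have "eventually (\<lambda>n. dist (\<Sum>i<n. (coord x i)\<^sup>2) (suminf (\<lambda>i. (coord x i)\<^sup>2)) < e\<^sup>2) sequentially"
    using summable_LIMSEQ[OF s] by (intro tendstoD) auto
  then obtain N where N: "\<And>n. n \<ge> N \<Longrightarrow> \<bar>(\<Sum>i<n. (coord x i)\<^sup>2) - (norm x)\<^sup>2\<bar> < e\<^sup>2"
    unfolding power2_norm_eq_inner inner_ell2.rep_eq eventually_sequentially dist_real_def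
    by (auto simp: power2_eq_square)
  have "dist (\<Sum>i<n. coord x i *\<^sub>R unit_vec i) x < e" if "n \<ge> N" for n
  proof -
    let ?p = "\<Sum>i<n. coord x i *\<^sub>R unit_vec i"
    have "inner x ?p = (\<Sum>i<n. (coord x i)\<^sup>2)"
      by (simp add: inner_sum_right inner_unit_vec power2_eq_square)
    moreover have "inner ?p ?p = (\<Sum>i<n. (coord x i)\<^sup>2)"
      using norm_sum_unit_vec[of "{..<n}" "coord x"] by (simp add: power2_norm_eq_inner)
    ultimately have "(norm (?p - x))\<^sup>2 = (norm x)\<^sup>2 - (\<Sum>i<n. (coord x i)\<^sup>2)"
      by (simp add: power2_norm_eq_inner inner_diff_left inner_diff_right inner_commute)
    also have "\<dots> < e\<^sup>2" using N[OF that] by linarith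
    finally show ?thesis
      using \<open>e > 0\<close> by (simp add: dist_norm power2_less_imp_less)
  qed
  then show "\<exists>N. \<forall>n\<ge>N. dist (\<Sum>i<n. coord x i *\<^sub>R unit_vec i) x < e" by blast
qed

section \<open>Positive semidefinite forms and Gram--Schmidt\<close>

locale psd_form =
  fixes B :: "'a::real_vector \<Rightarrow> 'a \<Rightarrow> real"
  assumes add_left: "B (x + y) z = B x z + B y z"
    and scale_left: "B (c *\<^sub>R x) z = c * B x z"
    and sym: "B x y = B y x"
    and nonneg: "0 \<le> B x x"
begin

lemma add_right: "B z (x + y) = B z x + B z y"
  by (metis add_left sym)

lemma scale_right: "B z (c *\<^sub>R x) = c * B z x"
  by (metis scale_left sym)

lemma zero_left [simp]: "B 0 x = 0"
  using scale_left[of 0 0 x] by simp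

lemma zero_right [simp]: "B x 0 = 0"
  by (subst sym) simp

lemma diff_left: "B (x - y) z = B x z - B y z"
  using add_left[of "x - y" y z] by simp

lemma diff_right: "B z (x - y) = B z x - B z y"
  by (metis diff_left sym)

lemma sum_left: "B (sum f F) z = (\<Sum>i\<in>F. B (f i) z)"
  by (induction F rule: infinite_finite_induct) (auto simp: add_left)

lemma sum_right: "B z (sum f F) = (\<Sum>i\<in>F. B z (f i))"
  by (induction F rule: infinite_finite_induct) (auto simp: add_right)

lemma Cauchy_Schwarz: "(B x y)\<^sup>2 \<le> B x x * B y y"
proof (cases "B y y = 0")
  case True
  have "B x y = 0"
  proof (rule ccontr)
    assume n: "B x y \<noteq> 0"
    \<comment> \<open>With \<open>B y y = 0\<close> the form is affine in the coefficient of
      \<open>y\<close>; this coefficient gives it the value -1.\<close>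
    let ?t = "- (B x x + 1) / (2 * B x y)"
    have "B (x + ?t *\<^sub>R y) (x + ?t *\<^sub>R y) = B x x + 2 * ?t * B x y"
      using True by (simp add: add_left add_right scale_left scale_right sym[of y x])
    also have "\<dots> = -1" using n by (simp add: field_simps)
    finally show False using nonneg[of "x + ?t *\<^sub>R y"] by simp
  qed
  then show ?thesis using True by simp
next
  case False
  then have pos: "B y y > 0" using nonneg[of y] by simp
  let ?t = "B x y / B y y"
  have "0 \<le> B (x - ?t *\<^sub>R y) (x - ?t *\<^sub>R y)" by (rule nonneg)
  also have "\<dots> = B x x - (B x y)\<^sup>2 / B y y"
    using pos by (simp add: diff_left diff_right scale_left scale_right sym[of y x] power2_eq_square)
  finally show ?thesis using pos by (simp add: field_simps)
qed

lemma null_left: "B x x = 0 \<Longrightarrow> B x y = 0"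
  using Cauchy_Schwarz[of x y] by simp

lemma add_le: "B (x + y) (x + y) \<le> 2 * B x x + 2 * B y y"
  using nonneg[of "x - y"] by (simp add: add_left add_right diff_left diff_right)

text \<open>Convexity of the quadratic form: the sum of the squared deviations from the mean is
  nonnegative.\<close>

lemma average_le:
  assumes "finite F" "F \<noteq> {}"
  shows "B ((\<Sum>i\<in>F. f i) /\<^sub>R card F) ((\<Sum>i\<in>F. f i) /\<^sub>R card F) \<le> (\<Sum>i\<in>F. B (f i) (f i)) / card F"
proof -
  let ?m = "(\<Sum>i\<in>F. f i) /\<^sub>R card F"
  have c: "card F > 0" using assms by (simp add: card_gt_0_iff)
  have s: "(\<Sum>i\<in>F. f i) = real (card F) *\<^sub>R ?m" using c by simp
  have "0 \<le> (\<Sum>i\<in>F. B (f i - ?m) (f i - ?m))" by (intro sum_nonneg nonneg)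
  also have "\<dots> = (\<Sum>i\<in>F. B (f i) (f i)) - 2 * (\<Sum>i\<in>F. B (f i) ?m) + card F * B ?m ?m"
  proof -
    have "B (f i - ?m) (f i - ?m) = B (f i) (f i) - 2 * B (f i) ?m + B ?m ?m" for i
      unfolding diff_left diff_right using sym[of ?m "f i"] by simp
    then show ?thesis by (simp only: sum.distrib sum_subtractf sum_distrib_left[symmetric]) simp
  qed
  also have "(\<Sum>i\<in>F. B (f i) ?m) = card F * B ?m ?m"
    unfolding sum_left[symmetric] by (subst (1) s) (rule scale_left)
  finally have "card F * B ?m ?m \<le> (\<Sum>i\<in>F. B (f i) (f i))" by simp
  then show ?thesis using c by (simp add: field_simps)
qed

section \<open>Gram-Schmidt for degenerate forms\<close>

context
  fixes v :: "nat \<Rightarrow> 'a"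
  notes sum.cong [fundef_cong]
begin

text \<open>A residual with \<open>B w w = 0\<close> is replaced by 0, since inverting
  \<open>sqrt 0\<close> yields 0; thus input and output keep the same indices. The congruence rule
  for sums lets the termination proof see \<open>i < k\<close>.\<close>

fun gram_schmidt :: "nat \<Rightarrow> 'a" where
  "gram_schmidt k =
    (let w = v k - (\<Sum>i<k. B (v k) (gram_schmidt i) *\<^sub>R gram_schmidt i) in w /\<^sub>R sqrt (B w w))"

declare gram_schmidt.simps [simp del]

lemma gram_schmidt_step:
  assumes "w = v k - (\<Sum>i<k. B (v k) (gram_schmidt i) *\<^sub>R gram_schmidt i)"
  shows "gram_schmidt k = w /\<^sub>R sqrt (B w w)"
  by (simp add: gram_schmidt.simps[of k] assms Let_def)

lemma gram_schmidt_self: "B (gram_schmidt k) (gram_schmidt k) = (if gram_schmidt k = 0 then 0 else 1)"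
proof -
  define w where "w = v k - (\<Sum>i<k. B (v k) (gram_schmidt i) *\<^sub>R gram_schmidt i)"
  have e: "gram_schmidt k = w /\<^sub>R sqrt (B w w)" by (rule gram_schmidt_step) (rule w_def)
  show ?thesis
  proof (cases "B w w = 0")
    case False
    then have "B w w > 0" using nonneg[of w] by simp
    then have "B (gram_schmidt k) (gram_schmidt k) = 1"
      by (simp add: e scale_left scale_right field_simps)
    then show ?thesis by auto
  qed (simp add: e)
qed

lemma gram_schmidt_orthogonal: "i \<noteq> j \<Longrightarrow> B (gram_schmidt i) (gram_schmidt j) = 0"
proof -
  have main: "\<forall>i<k. B (gram_schmidt k) (gram_schmidt i) = 0" for k
  proof (induction k rule: less_induct)
    case (less k)
    have orth: "B (gram_schmidt i) (gram_schmidt j) = 0" if "i < k" "j < k" "i \<noteq> j" for i j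
      using less that by (metis sym nat_neq_iff)
    define w where "w = v k - (\<Sum>i<k. B (v k) (gram_schmidt i) *\<^sub>R gram_schmidt i)"
    have e: "gram_schmidt k = w /\<^sub>R sqrt (B w w)" by (rule gram_schmidt_step) (rule w_def)
    have "B w (gram_schmidt i) = 0" if "i < k" for i
    proof -
      have "(\<Sum>j<k. B (v k) (gram_schmidt j) * B (gram_schmidt j) (gram_schmidt i)) =
          (\<Sum>j\<in>{i}. B (v k) (gram_schmidt j) * B (gram_schmidt j) (gram_schmidt i))"
        using that orth by (intro sum.mono_neutral_right) auto
      then show ?thesis
        by (auto simp: w_def diff_left sum_left scale_left gram_schmidt_self)
    qed
    then show ?case by (simp add: e scale_left)
  qed
  assume "i \<noteq> j"
  then show ?thesis using main sym by (metis nat_neq_iff)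
qed

text \<open>For a degenerate form \<open>v k\<close> need not equal its expansion, but the
  difference is a null vector, which by \<open>null_left\<close> is invisible to
  \<open>B\<close>.\<close>

lemma gram_schmidt_residual:
  fixes k :: nat
  defines "r \<equiv> v k - (\<Sum>i\<le>k. B (v k) (gram_schmidt i) *\<^sub>R gram_schmidt i)"
  shows "B r r = 0"
proof -
  define w where "w = v k - (\<Sum>i<k. B (v k) (gram_schmidt i) *\<^sub>R gram_schmidt i)"
  have e: "gram_schmidt k = w /\<^sub>R sqrt (B w w)" by (rule gram_schmidt_step) (rule w_def)
  have r: "r = w - B (v k) (gram_schmidt k) *\<^sub>R gram_schmidt k"
    by (simp add: r_def w_def lessThan_Suc_atMost[symmetric])
  show ?thesis
  proof (cases "B w w = 0")
    case True
    then show ?thesis by (simp add: r e)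
  next
    case False
    then have pos: "B w w > 0" using nonneg[of w] by simp
    have "v k = w + (\<Sum>i<k. B (v k) (gram_schmidt i) *\<^sub>R gram_schmidt i)" by (simp add: w_def)
    then have "B (v k) (gram_schmidt k) =
        B w (gram_schmidt k) + (\<Sum>i<k. B (v k) (gram_schmidt i) * B (gram_schmidt i) (gram_schmidt k))"
      by (metis (no_types, lifting) add_left sum_left scale_left sum.cong)
    also have "\<dots> = B w (gram_schmidt k)"
      by (simp add: gram_schmidt_orthogonal)
    also have "\<dots> = B w w / sqrt (B w w)"
      by (simp add: e scale_right divide_inverse mult.commute)
    also have "\<dots> = sqrt (B w w)" using pos by (simp add: real_div_sqrt)
    finally have "r = 0" using pos unfolding r e by simp
    then show ?thesis by simp
  qed
qed

lemma gram_schmidt_expand_left: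
  "B (v k) x = (\<Sum>i\<le>k. B (v k) (gram_schmidt i) * B (gram_schmidt i) x)"
  using null_left[OF gram_schmidt_residual[of k], of x] by (simp add: diff_left sum_left scale_left)

text \<open>Up to a null vector \<open>v k\<close> is a combination of the entries up to
  \<open>k\<close>, to which later entries are orthogonal. So Gram matrices are finite sums of
  products of coefficients.\<close>

lemma gram_schmidt_triangular: "k < i \<Longrightarrow> B (v k) (gram_schmidt i) = 0"
  by (subst gram_schmidt_expand_left) (simp add: gram_schmidt_orthogonal)

lemma gram_schmidt_in_span: "gram_schmidt k \<in> span (range v)"
proof (induction k rule: less_induct)
  case (less k)
  then show ?case
    unfolding gram_schmidt.simps[of k] Let_def
    by (intro span_scale span_diff span_sum) (auto intro: span_base)
qed

text \<open>Bessel's inequality for one coefficient. It supplies the bounds needed for compactness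
  in \<open>gram_matrix_limit\<close>.\<close>

lemma gram_schmidt_coeff_le: "(B (v k) (gram_schmidt i))\<^sup>2 \<le> B (v k) (v k)"
proof -
  have "(B (v k) (gram_schmidt i))\<^sup>2 \<le> B (v k) (v k) * B (gram_schmidt i) (gram_schmidt i)"
    by (rule Cauchy_Schwarz)
  also have "\<dots> \<le> B (v k) (v k)"
    using nonneg[of "v k"] by (simp add: gram_schmidt_self)
  finally show ?thesis .
qed

end

end

section \<open>The inner product as a form; operators on \<open>ell2\<close> given by their
  columns\<close>

interpretation inner: psd_form "inner :: 'a::real_inner \<Rightarrow> 'a \<Rightarrow> real"
  by unfold_locales (simp_all only: inner_add_left inner_scaleR_left inner_ge_zero, rule inner_commute)

text \<open>The estimate on finite combinations makes the series for \<open>L x\<close> Cauchy, and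
  it passes to the sum with the same constant.\<close>

lemma ell2_operator_of_columns:
  fixes a :: "nat \<Rightarrow> 'b::banach"
  assumes bound: "\<And>F c. finite F \<Longrightarrow> (norm (\<Sum>n\<in>F. c n *\<^sub>R a n))\<^sup>2 \<le> K\<^sup>2 * (\<Sum>n\<in>F. (c n)\<^sup>2)"
    and K: "0 \<le> K"
  shows "\<exists>L. bounded_linear L \<and> (\<forall>n. L (unit_vec n) = a n) \<and> (\<forall>x. norm (L x) \<le> K * norm x)"
proof -
  have summ: "summable (\<lambda>n. coord x n *\<^sub>R a n)" for x
    unfolding summable_Cauchy
  proof (intro allI impI)
    fix e :: real assume "e > 0"
    have s: "summable (\<lambda>n. (coord x n)\<^sup>2)" using coord[of x] by (simp add: l2_def)
    \<comment> \<open>\<open>K + 1\<close> instead of \<open>K\<close> covers \<open>K = 0\<close>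
      and keeps the final inequality strict.\<close>
    have "(e / (K + 1))\<^sup>2 > 0" using \<open>e > 0\<close> K by simp
    from s[unfolded summable_Cauchy, rule_format, OF this]
    obtain N where N: "\<And>m n. m \<ge> N \<Longrightarrow> norm (\<Sum>i=m..<n. (coord x i)\<^sup>2) < (e / (K + 1))\<^sup>2"
      by blast
    have "norm (\<Sum>i=m..<n. coord x i *\<^sub>R a i) < e" if "m \<ge> N" for m n
    proof -
      have "(norm (\<Sum>i=m..<n. coord x i *\<^sub>R a i))\<^sup>2 \<le> K\<^sup>2 * (\<Sum>i=m..<n. (coord x i)\<^sup>2)"
        by (rule bound) simp
      also have "\<dots> \<le> K\<^sup>2 * (e / (K + 1))\<^sup>2"
        using N[OF that, of n] by (intro mult_left_mono) auto
      also have "\<dots> = (K / (K + 1) * e)\<^sup>2" by (simp add: power_mult_distrib power_divide)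
      also have "\<dots> < e\<^sup>2"
        using K \<open>e > 0\<close> by (intro power_strict_mono) (auto simp: field_simps)
      finally show ?thesis using \<open>e > 0\<close> by (simp add: power2_less_imp_less)
    qed
    then show "\<exists>N. \<forall>m\<ge>N. \<forall>n. norm (\<Sum>i=m..<n. coord x i *\<^sub>R a i) < e" by blast
  qed
  define L where "L x = suminf (\<lambda>n. coord x n *\<^sub>R a n)" for x
  have norm_L: "norm (L x) \<le> K * norm x" for x
  proof -
    have "(\<lambda>n. norm (\<Sum>i<n. coord x i *\<^sub>R a i)) \<longlonglongrightarrow> norm (L x)"
      unfolding L_def by (intro tendsto_norm summable_LIMSEQ summ)
    moreover have "norm (\<Sum>i<n. coord x i *\<^sub>R a i) \<le> K * norm x" for n
    proof -
      have "(norm (\<Sum>i<n. coord x i *\<^sub>R a i))\<^sup>2 \<le> K\<^sup>2 * (\<Sum>i<n. (coord x i)\<^sup>2)"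
        by (rule bound) simp
      also have "\<dots> \<le> (K * norm x)\<^sup>2"
        unfolding power_mult_distrib by (intro mult_left_mono sum_coord_le_norm) simp
      finally show ?thesis by (rule power2_le_imp_le) (simp add: K)
    qed
    ultimately show ?thesis by (blast intro: LIMSEQ_le_const2)
  qed
  have "bounded_linear L"
  proof (rule bounded_linear_intro)
    show "L (x + y) = L x + L y" for x y
      by (simp add: L_def scaleR_left_distrib suminf_add summ)
    show "L (c *\<^sub>R x) = c *\<^sub>R L x" for c x
      using suminf_scaleR_right[OF summ, of c x] by (simp add: L_def)
    show "norm (L x) \<le> norm x * K" for x
      using norm_L[of x] by (simp add: mult.commute)
  qed
  moreover have "L (unit_vec n) = a n" for n
  proof -
    have "L (unit_vec n) = (\<Sum>k\<in>{n}. coord (unit_vec n) k *\<^sub>R a k)"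
      unfolding L_def by (rule suminf_finite) (auto simp: coord_unit_vec)
    then show ?thesis by (simp add: coord_unit_vec)
  qed
  ultimately show ?thesis using norm_L by blast
qed

lemma ell2_operator_eqI:
  assumes "bounded_linear f" "bounded_linear g" "\<And>n. f (unit_vec n) = g (unit_vec n)"
  shows "f x = g x"
proof -
  have "(\<lambda>n. coord x n *\<^sub>R f (unit_vec n)) sums f x"
    using bounded_linear.sums[OF assms(1) unit_vec_expansion[of x]]
    by (simp add: linear_scale bounded_linear.linear assms(1))
  moreover have "(\<lambda>n. coord x n *\<^sub>R g (unit_vec n)) sums g x"
    using bounded_linear.sums[OF assms(2) unit_vec_expansion[of x]]
    by (simp add: linear_scale bounded_linear.linear assms(2))
  ultimately show ?thesis using assms(3) sums_unique2 by simp
qed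

section \<open>Cocycles over a bounded linear representation\<close>

text \<open>\<open>y\<close> is the orbit of the origin under the affine action with linear part
  \<open>T\<close> and translation part \<open>y\<close>. Each \<open>T \<gamma>\<close> is linear
  on the whole type, but it is determined and bounded only on the span of \<open>y\<close>.\<close>

locale bounded_cocycle = group G for G (structure) +
  fixes T :: "'a \<Rightarrow> 'v::real_inner \<Rightarrow> 'v" and y :: "'a \<Rightarrow> 'v" and K :: "'a \<Rightarrow> real"
  assumes T_linear: "\<gamma> \<in> carrier G \<Longrightarrow> linear (T \<gamma>)"
    and T_cocycle: "\<gamma> \<in> carrier G \<Longrightarrow> g \<in> carrier G \<Longrightarrow> T \<gamma> (y g) = y (\<gamma> \<otimes> g) - y \<gamma>"
    and T_bound: "\<gamma> \<in> carrier G \<Longrightarrow> x \<in> span (y ` carrier G) \<Longrightarrow> norm (T \<gamma> x) \<le> K \<gamma> * norm x"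
    and y_one: "y \<one> = 0"
    and K_nonneg: "\<gamma> \<in> carrier G \<Longrightarrow> 0 \<le> K \<gamma>"
begin

abbreviation "V \<equiv> span (y ` carrier G)"

lemma T_in_V:
  assumes "\<gamma> \<in> carrier G" "x \<in> V" shows "T \<gamma> x \<in> V"
proof -
  have "T \<gamma> ` V = span (T \<gamma> ` y ` carrier G)"
    using linear_span_image[OF T_linear[OF assms(1)]] by simp
  also have "\<dots> \<subseteq> V"
    using assms(1) by (intro span_minimal) (auto simp: T_cocycle intro!: span_diff[OF span_base span_base])
  finally show ?thesis using assms(2) by blast
qed

lemma T_one: "x \<in> V \<Longrightarrow> T \<one> x = x"
  by (rule linear_eq_on[OF T_linear linear_id[unfolded id_def]]) (auto simp: T_cocycle y_one)

lemma T_mult: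
  assumes "\<gamma> \<in> carrier G" "\<eta> \<in> carrier G" "x \<in> V"
  shows "T (\<gamma> \<otimes> \<eta>) x = T \<gamma> (T \<eta> x)"
proof (rule linear_eq_on[where f = "T (\<gamma> \<otimes> \<eta>)" and g = "\<lambda>x. T \<gamma> (T \<eta> x)" and B = "y ` carrier G"])
  show "linear (T (\<gamma> \<otimes> \<eta>))" using assms by (simp add: T_linear)
  show "linear (\<lambda>x. T \<gamma> (T \<eta> x))"
    using linear_compose[OF T_linear T_linear] assms by (simp add: o_def)
qed (use assms in \<open>auto simp: T_cocycle linear_diff[OF T_linear] m_assoc\<close>)

text \<open>The representation acts by the same operators on each of countably many orthogonal
  copies of \<open>V\<close>. A finite combination of basis vectors splits into its components in
  the copies, so by Pythagoras the constant stays \<open>K \<gamma>\<close>. The map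
  \<open>f\<close> is the embedding as copy 0.\<close>

lemma realisation_on_l2:
  assumes cnt: "countable (carrier G)" and nz: "\<exists>g\<in>carrier G. y g \<noteq> 0"
  shows "\<exists>A' f. (\<forall>\<gamma>\<in>carrier G. bounded_linear (A' \<gamma>) \<and> (\<forall>x. norm (A' \<gamma> x) \<le> K \<gamma> * norm x))
     \<and> (\<forall>x. A' \<one> x = x) \<and> (\<forall>\<gamma>\<in>carrier G. \<forall>\<eta>\<in>carrier G. \<forall>x. A' (\<gamma> \<otimes> \<eta>) x = A' \<gamma> (A' \<eta> x))
     \<and> linear f \<and> (\<forall>\<gamma>\<in>carrier G. \<forall>x\<in>V. f (T \<gamma> x) = A' \<gamma> (f x)) \<and> (\<forall>x\<in>V. norm (f x :: ell2) = norm x)"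
proof -
  define v where "v k = y (from_nat_into (carrier G) k)" for k
  have range_v: "range v = y ` carrier G"
  proof -
    have "range (from_nat_into (carrier G)) = carrier G"
      using cnt by (intro range_from_nat_into) auto
    then show ?thesis unfolding v_def by (simp only: image_image[symmetric])
  qed
  define e where "e = inner.gram_schmidt v"
  \<comment> \<open>The zero entries of the Gram-Schmidt output are dropped; the remaining ones are
    orthonormal.\<close>
  define I where "I = {k. e k \<noteq> 0}"
  have e_inner: "e i \<bullet> e j = (if i = j then 1 else 0)" if "i \<in> I" for i j
    using that inner.gram_schmidt_self[of v i] inner.gram_schmidt_orthogonal[of i j v]
    by (auto simp: e_def I_def)
  have e_V: "e k \<in> V" for k
    using inner.gram_schmidt_in_span[of v k] range_v by (simp add: e_def)
  \<comment> \<open>For a genuine inner product null vectors vanish, so the vectors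
    \<open>e k\<close> span \<open>V\<close> algebraically, without closure.\<close>
  have "v k \<in> span (e ` I)" for k
  proof -
    have "v k = (\<Sum>i\<le>k. (v k \<bullet> e i) *\<^sub>R e i)"
      using inner.gram_schmidt_residual[of v k] by (simp add: e_def)
    moreover have "e i \<in> span (e ` I)" for i
      by (cases "i \<in> I") (auto simp: I_def span_zero intro: span_base)
    ultimately show ?thesis by (metis (no_types, lifting) span_sum span_scale)
  qed
  then have "V \<subseteq> span (e ` I)"
    unfolding range_v[symmetric] by (intro span_minimal) auto
  moreover have "span (e ` I) \<subseteq> V"
    using e_V by (intro span_minimal) auto
  ultimately have V_eq: "V = span (e ` I)" by blast
  have e_inj: "inj_on e I"
    using e_inner by (metis inj_onI zero_neq_one)
  have "pairwise orthogonal (e ` I)"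
    unfolding pairwise_def orthogonal_def using e_inner by fastforce
  then have indep: "independent (e ` I)"
    by (rule pairwise_orthogonal_independent) (auto simp: I_def)
  have "I \<noteq> {}"
  proof
    assume "I = {}"
    then have "V = {0}" using V_eq by simp
    moreover from nz obtain g where "g \<in> carrier G" "y g \<noteq> 0" by blast
    ultimately show False using span_base[of "y g" "y ` carrier G"] by simp
  qed
  \<comment> \<open>The factor \<open>UNIV\<close> makes the index set infinite even if
    \<open>I\<close> is finite, so the natural numbers enumerate it bijectively.\<close>
  then have inf: "infinite (I \<times> (UNIV :: nat set))"
    using finite_cartesian_productD2 by blast
  define \<beta> where "\<beta> = from_nat_into (I \<times> (UNIV :: nat set))"
  have \<beta>: "bij_betw \<beta> UNIV (I \<times> UNIV)"
    unfolding \<beta>_def by (rule bij_betw_from_nat_into[OF _ inf]) simp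
  define idx where "idx = inv_into UNIV \<beta>"
  have idx_\<beta>: "idx (\<beta> n) = n" for n
    using \<beta> by (simp add: idx_def bij_betw_def)
  have \<beta>_idx: "\<beta> (idx p) = p" if "p \<in> I \<times> UNIV" for p
    using \<beta> that by (simp add: idx_def bij_betw_def f_inv_into_f)
  have \<beta>_I: "fst (\<beta> n) \<in> I" for n
    using \<beta> unfolding bij_betw_def by (metis UNIV_I imageI mem_Times_iff)
  \<comment> \<open>\<open>J i\<close> will embed \<open>V\<close> isometrically as copy
    \<open>i\<close>; it exists because the \<open>e k\<close> are independent.\<close>
  have "\<exists>J. linear J \<and> (\<forall>k\<in>I. J (e k) = unit_vec (idx (k, i)))" for i
  proof -
    obtain J where "linear J" "\<forall>x\<in>e ` I. J x = unit_vec (idx (inv_into I e x, i))"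
      using linear_independent_extend[OF indep, of "\<lambda>x. unit_vec (idx (inv_into I e x, i))"] by blast
    then show ?thesis using e_inj by auto
  qed
  then obtain J where J_lin: "\<And>i. linear (J i)" and J_e: "\<And>i k. k \<in> I \<Longrightarrow> J i (e k) = unit_vec (idx (k, i))"
    by metis
  have J_inner: "J i x \<bullet> J i' x' = (if i = i' then x \<bullet> x' else 0)" if "x \<in> V" "x' \<in> V" for i i' x x'
  proof -
    have lin1: "linear (\<lambda>x. J i x \<bullet> c)" for i c
      by (rule linearI) (simp_all add: linear_add[OF J_lin] linear_scale[OF J_lin] inner_add_left)
    have lin2: "linear (\<lambda>x. if i = i' then x \<bullet> c else 0)" for c :: 'v
      by (rule linearI) (auto simp: inner_add_left)
    have ee: "J i (e k) \<bullet> J i' (e k') = (if i = i' then e k \<bullet> e k' else 0)" if "k \<in> I" "k' \<in> I" for k k'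
    proof -
      have "idx (k, i) = idx (k', i') \<longleftrightarrow> k = k' \<and> i = i'"
        using that \<beta>_idx by (metis Pair_inject SigmaI UNIV_I)
      then have "coord (unit_vec (idx (k, i))) (idx (k', i')) = (if k = k' \<and> i = i' then 1 else 0)"
        unfolding coord_unit_vec by (metis (full_types))
      then show ?thesis
        unfolding J_e[OF that(1)] J_e[OF that(2)] inner_unit_vec e_inner[OF that(1)] by simp
    qed
    have xe: "J i x \<bullet> J i' (e k') = (if i = i' then x \<bullet> e k' else 0)" if "k' \<in> I" for k'
      by (rule linear_eq_on[OF lin1[of i "J i' (e k')"] lin2[of "e k'"], of x "e ` I"])
        (use \<open>x \<in> V\<close> V_eq ee that in blast)+
    have "J i' x' \<bullet> J i x = (if i = i' then x' \<bullet> x else 0)"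
      by (rule linear_eq_on[OF lin1[of i' "J i x"] lin2[of x], of x' "e ` I"])
        (use \<open>x' \<in> V\<close> V_eq xe in \<open>fastforce simp: inner_commute\<close>)+
    then show ?thesis by (simp add: inner_commute)
  qed
  \<comment> \<open>A finite combination of columns is split by the copy they belong to; this is
    used for \<open>T \<gamma>\<close> and for the identity as \<open>L\<close>.\<close>
  have J_group: "(\<Sum>n\<in>F. c n *\<^sub>R J (snd (\<beta> n)) (L (e (fst (\<beta> n))))) =
      (\<Sum>i\<in>(\<lambda>n. snd (\<beta> n)) ` F. J i (L (\<Sum>n\<in>{n\<in>F. snd (\<beta> n) = i}. c n *\<^sub>R e (fst (\<beta> n)))))"
    if "finite F" "linear L" for F c L
  proof -
    have "J i (L (\<Sum>n\<in>{n\<in>F. snd (\<beta> n) = i}. c n *\<^sub>R e (fst (\<beta> n)))) =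
        (\<Sum>n\<in>{n\<in>F. snd (\<beta> n) = i}. c n *\<^sub>R J (snd (\<beta> n)) (L (e (fst (\<beta> n)))))" for i
      by (simp add: linear_sum[OF \<open>linear L\<close>] linear_scale[OF \<open>linear L\<close>] linear_sum[OF J_lin] linear_scale[OF J_lin])
    then have "(\<Sum>i\<in>(\<lambda>n. snd (\<beta> n)) ` F. J i (L (\<Sum>n\<in>{n\<in>F. snd (\<beta> n) = i}. c n *\<^sub>R e (fst (\<beta> n))))) =
        (\<Sum>i\<in>(\<lambda>n. snd (\<beta> n)) ` F. \<Sum>n\<in>{n\<in>F. snd (\<beta> n) = i}. c n *\<^sub>R J (snd (\<beta> n)) (L (e (fst (\<beta> n)))))"
      by (rule sum.cong[OF refl])
    also have "\<dots> = (\<Sum>n\<in>F. c n *\<^sub>R J (snd (\<beta> n)) (L (e (fst (\<beta> n)))))"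
      using \<open>finite F\<close> by (intro sum.group) auto
    finally show ?thesis by (rule HOL.sym)
  qed
  have J_pyth: "(norm (\<Sum>i\<in>F. J i (x i)))\<^sup>2 = (\<Sum>i\<in>F. (norm (x i))\<^sup>2)" if "finite F" "\<And>i. x i \<in> V" for F x
    unfolding power2_norm_eq_inner inner_sum_left inner_sum_right
    by (simp add: J_inner that if_distrib sum.delta cong: if_cong)
  \<comment> \<open>The operator is prescribed on unit vectors. Grouping by copies reduces the
    column estimate to \<open>T_bound\<close> on the components \<open>w i\<close>.\<close>
  have "\<exists>L. bounded_linear L \<and> (\<forall>n. L (unit_vec n) = J (snd (\<beta> n)) (T \<gamma> (e (fst (\<beta> n)))))
      \<and> (\<forall>x. norm (L x) \<le> K \<gamma> * norm x)" if \<gamma>: "\<gamma> \<in> carrier G" for \<gamma>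
  proof (rule ell2_operator_of_columns)
    fix F :: "nat set" and c :: "nat \<Rightarrow> real" assume "finite F"
    define w where "w i = (\<Sum>n\<in>{n\<in>F. snd (\<beta> n) = i}. c n *\<^sub>R e (fst (\<beta> n)))" for i
    have w: "w i \<in> V" for i
      unfolding w_def by (intro span_sum span_scale e_V)
    have unit: "unit_vec n = J (snd (\<beta> n)) (e (fst (\<beta> n)))" for n
      by (simp add: J_e \<beta>_I idx_\<beta>)
    have "(norm (\<Sum>n\<in>F. c n *\<^sub>R J (snd (\<beta> n)) (T \<gamma> (e (fst (\<beta> n))))))\<^sup>2 =
        (\<Sum>i\<in>(\<lambda>n. snd (\<beta> n)) ` F. (norm (T \<gamma> (w i)))\<^sup>2)"
      unfolding J_group[OF \<open>finite F\<close> T_linear[OF \<gamma>]] w_def[symmetric]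
      using w \<gamma> T_in_V \<open>finite F\<close> by (intro J_pyth) auto
    also have "\<dots> \<le> (\<Sum>i\<in>(\<lambda>n. snd (\<beta> n)) ` F. (K \<gamma>)\<^sup>2 * (norm (w i))\<^sup>2)"
      unfolding power_mult_distrib[symmetric] using T_bound[OF \<gamma> w] by (intro sum_mono power_mono) auto
    also have "\<dots> = (K \<gamma>)\<^sup>2 * (norm (\<Sum>i\<in>(\<lambda>n. snd (\<beta> n)) ` F. J i (w i)))\<^sup>2"
      using w \<open>finite F\<close> by (subst J_pyth) (auto simp: sum_distrib_left)
    also have "(\<Sum>i\<in>(\<lambda>n. snd (\<beta> n)) ` F. J i (w i)) = (\<Sum>n\<in>F. c n *\<^sub>R unit_vec n)"
      unfolding unit w_def using J_group[OF \<open>finite F\<close> linear_id, of c] by simp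
    also have "(norm \<dots>)\<^sup>2 = (\<Sum>n\<in>F. (c n)\<^sup>2)"
      using \<open>finite F\<close> by (rule norm_sum_unit_vec)
    finally show "(norm (\<Sum>n\<in>F. c n *\<^sub>R J (snd (\<beta> n)) (T \<gamma> (e (fst (\<beta> n))))))\<^sup>2 \<le> (K \<gamma>)\<^sup>2 * (\<Sum>n\<in>F. (c n)\<^sup>2)" .
  qed (rule K_nonneg[OF \<gamma>])
  then obtain A' where A'_bl: "\<And>\<gamma>. \<gamma> \<in> carrier G \<Longrightarrow> bounded_linear (A' \<gamma>)"
    and A'_unit: "\<And>\<gamma> n. \<gamma> \<in> carrier G \<Longrightarrow> A' \<gamma> (unit_vec n) = J (snd (\<beta> n)) (T \<gamma> (e (fst (\<beta> n))))"
    and A'_norm: "\<And>\<gamma> x. \<gamma> \<in> carrier G \<Longrightarrow> norm (A' \<gamma> x) \<le> K \<gamma> * norm x"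
    by metis
  have A'_J: "A' \<gamma> (J i x) = J i (T \<gamma> x)" if "\<gamma> \<in> carrier G" "x \<in> V" for \<gamma> i x
  proof (rule linear_eq_on[where f = "\<lambda>x. A' \<gamma> (J i x)" and g = "\<lambda>x. J i (T \<gamma> x)" and B = "e ` I"])
    show "linear (\<lambda>x. A' \<gamma> (J i x))"
      using linear_compose[OF J_lin bounded_linear.linear[OF A'_bl]] that by (simp add: o_def)
    show "linear (\<lambda>x. J i (T \<gamma> x))"
      using linear_compose[OF T_linear J_lin] that by (simp add: o_def)
    show "x \<in> span (e ` I)" using that V_eq by simp
    show "A' \<gamma> (J i b) = J i (T \<gamma> b)" if "b \<in> e ` I" for b
      using that \<open>\<gamma> \<in> carrier G\<close> by (auto simp: J_e A'_unit \<beta>_idx)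
  qed
  have A'_one: "A' \<one> x = x" for x
    by (rule ell2_operator_eqI[OF A'_bl bounded_linear_ident])
      (simp_all add: A'_unit T_one[OF e_V] J_e \<beta>_I idx_\<beta>)
  have A'_mult: "A' (\<gamma> \<otimes> \<eta>) x = A' \<gamma> (A' \<eta> x)" if "\<gamma> \<in> carrier G" "\<eta> \<in> carrier G" for \<gamma> \<eta> x
    by (rule ell2_operator_eqI[OF A'_bl bounded_linear_compose[OF A'_bl A'_bl]])
      (use that in \<open>simp_all add: A'_unit T_mult[OF _ _ e_V] A'_J T_in_V[OF _ e_V]\<close>)
  have "norm (J 0 x) = norm x" if "x \<in> V" for x
    using J_inner[OF that that, of 0 0] by (simp add: norm_eq_sqrt_inner)
  then show ?thesis
    using A'_bl A'_norm A'_one A'_mult J_lin[of 0] A'_J[where i = 0]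
    by (intro exI[of _ A'] exI[of _ "J 0"]) auto
qed

end

section \<open>Words in the generators and countability\<close>

lemma (in group) generate_word:
  assumes "g \<in> generate G S" "S \<subseteq> carrier G" "\<forall>s\<in>S. inv s \<in> S"
  shows "\<exists>ws. set ws \<subseteq> S \<and> foldr (\<otimes>) ws \<one> = g"
proof -
  have foldr_closed: "foldr (\<otimes>) ws \<one> \<in> carrier G" if "set ws \<subseteq> S" for ws
    using that assms(2) by (induction ws) auto
  show ?thesis
    using assms(1)
  proof induction
    case one
    show ?case by (rule exI[of _ "[]"]) simp
  next
    case (incl h)
    then show ?case using assms(2) by (intro exI[of _ "[h]"]) auto
  next
    case (inv h)
    then show ?case using assms(2,3) by (intro exI[of _ "[inv h]"]) auto
  next
    case (eng h1 h2)
    then obtain u w where u: "set u \<subseteq> S" "foldr (\<otimes>) u \<one> = h1" and w: "set w \<subseteq> S" "foldr (\<otimes>) w \<one> = h2"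
      by blast
    have "foldr (\<otimes>) (u @ w) \<one> = foldr (\<otimes>) u \<one> \<otimes> foldr (\<otimes>) w \<one>"
      using u(1) w(1) assms(2) foldr_closed by (induction u) (auto simp: m_assoc subsetD)
    then show ?case using u w by (intro exI[of _ "u @ w"]) auto
  qed
qed

lemma (in group) countable_generate:
  assumes "finite S" "S \<subseteq> carrier G" "\<forall>s\<in>S. inv s \<in> S"
  shows "countable (generate G S)"
proof (rule countable_subset)
  show "generate G S \<subseteq> (\<lambda>ws. foldr (\<otimes>) ws \<one>) ` lists S"
    using generate_word[OF _ assms(2,3)] by (fastforce simp: image_iff)
  show "countable ((\<lambda>ws. foldr (\<otimes>) ws \<one>) ` lists S)"
    using assms(1) by (intro countable_image countable_lists) (rule countable_finite)
qed

section \<open>Removing the invariant vector; the harmonic map\<close>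

context bounded_cocycle
begin

text \<open>If the sum \<open>u\<close> of the cocycle over \<open>S\<close> is invariant, it can be projected away: the cocycle modulo
  \<open>u\<close> cannot vanish, since otherwise it would be an odd multiple of \<open>u\<close> on the symmetric set \<open>S\<close>.\<close>

lemma project_invariant_sum:
  assumes S: "finite S" "S \<subseteq> carrier G" "\<forall>s\<in>S. inv s \<in> S" "generate G S = carrier G"
    and inv: "\<And>s. s \<in> S \<Longrightarrow> T s (\<Sum>t\<in>S. y t) = (\<Sum>t\<in>S. y t)"
    and nz: "\<exists>s\<in>S. y s \<noteq> 0"
  shows "\<exists>T' y'. bounded_cocycle G T' (y' :: 'a \<Rightarrow> 'v) K \<and> (\<Sum>s\<in>S. y' s) = 0 \<and> (\<exists>g\<in>carrier G. y' g \<noteq> 0)"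
proof (cases "(\<Sum>s\<in>S. y s) = 0")
  case True
  then show ?thesis using nz S(2) bounded_cocycle_axioms by blast
next
  case False
  define u where "u = (\<Sum>s\<in>S. y s)"
  have u0: "u \<noteq> 0" using False by (simp add: u_def)
  have uV: "u \<in> V" unfolding u_def using S(2) by (intro span_sum span_base) auto
  \<comment> \<open>The elements fixing \<open>u\<close> are closed under products, and the symmetry
    of \<open>S\<close> covers inverses of generators.\<close>
  have T_u: "T \<gamma> u = u" if "\<gamma> \<in> carrier G" for \<gamma>
  proof -
    have "\<gamma> \<in> generate G S" using that S(4) by simp
    then show ?thesis
    proof induction
      case (eng h1 h2)
      then show ?case using T_mult[OF _ _ uV] S(4) by simp
    qed (use S(3) inv T_one[OF uV] in \<open>auto simp: u_def\<close>)
  qed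
  define \<tau> where "\<tau> x = (x \<bullet> u) / (u \<bullet> u)" for x
  define p where "p x = x - \<tau> x *\<^sub>R u" for x
  have p_lin: "linear p"
    by (rule linearI) (simp_all add: p_def \<tau>_def inner_add_left add_divide_distrib algebra_simps)
  have p_u: "p u = 0" using u0 by (simp add: p_def \<tau>_def)
  have p_V: "p x \<in> V" if "x \<in> V" for x
    unfolding p_def using that uV by (intro span_diff span_scale)
  have p_norm: "norm (p x) \<le> norm x" for x
  proof -
    have "norm (p x)^2 = norm x ^ 2 - (x \<bullet> u)\<^sup>2 / (u \<bullet> u)"
      using u0 unfolding power2_norm_eq_inner
      by (simp add: p_def \<tau>_def inner_diff_left inner_diff_right inner_commute field_simps power2_eq_square)
    also have "\<dots> \<le> norm x ^ 2" by simp
    finally show ?thesis by (rule power2_le_imp_le) simp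
  qed
  \<comment> \<open>\<open>p\<close> kills the invariant line, so \<open>p\<close> after
    \<open>T \<gamma>\<close> is the representation on the quotient by \<open>u\<close>, realised on
    the orthogonal complement.\<close>
  have pT: "p (T \<gamma> (p x)) = p (T \<gamma> x)" if "\<gamma> \<in> carrier G" for \<gamma> x
  proof -
    have "T \<gamma> (p x) = T \<gamma> x - \<tau> x *\<^sub>R u"
      using T_u[OF that] T_linear[OF that] by (simp add: p_def linear_diff linear_scale)
    then show ?thesis using p_lin p_u by (simp add: linear_diff linear_scale)
  qed
  have coc: "bounded_cocycle G (\<lambda>\<gamma> x. p (T \<gamma> x)) (\<lambda>g. p (y g)) K"
  proof (intro bounded_cocycle.intro bounded_cocycle_axioms.intro is_group)
    show "linear (\<lambda>x. p (T \<gamma> x))" if "\<gamma> \<in> carrier G" for \<gamma>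
      using linear_compose[OF T_linear[OF that] p_lin] by (simp add: o_def)
    show "p (T \<gamma> (p (y g))) = p (y (\<gamma> \<otimes> g)) - p (y \<gamma>)" if "\<gamma> \<in> carrier G" "g \<in> carrier G" for \<gamma> g
      using that by (simp add: pT T_cocycle linear_diff[OF p_lin])
    show "norm (p (T \<gamma> x)) \<le> K \<gamma> * norm x"
      if \<gamma>: "\<gamma> \<in> carrier G" and x: "x \<in> span ((\<lambda>g. p (y g)) ` carrier G)" for \<gamma> x
    proof -
      have "span ((\<lambda>g. p (y g)) ` carrier G) \<subseteq> V"
        using p_V by (intro span_minimal) (auto intro: span_base)
      then have "norm (T \<gamma> x) \<le> K \<gamma> * norm x" using \<gamma> x T_bound by blast
      then show ?thesis using p_norm[of "T \<gamma> x"] by linarith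
    qed
  qed (auto simp: y_one linear_0[OF p_lin] K_nonneg)
  have "\<exists>s\<in>S. p (y s) \<noteq> 0"
  proof (rule ccontr)
    assume "\<not> ?thesis"
    then have ys: "y s = \<tau> (y s) *\<^sub>R u" if "s \<in> S" for s
      using that by (simp add: p_def)
    \<comment> \<open>\<open>T s\<close> fixes the line of \<open>u\<close> pointwise, so
      \<open>y (inv s) = T s (y (inv s)) = y \<one> - y s\<close>.\<close>
    have odd: "\<tau> (y (inv s)) = - \<tau> (y s)" if "s \<in> S" for s
    proof -
      have s: "s \<in> carrier G" using that S(2) by auto
      have i: "inv s \<in> S" using that S(3) by auto
      have "\<tau> (y (inv s)) *\<^sub>R u = T s (y (inv s))"
        by (subst (2) ys[OF i]) (simp add: linear_scale[OF T_linear[OF s]] T_u[OF s])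
      also have "\<dots> = - y s" using s by (simp add: T_cocycle y_one)
      also have "\<dots> = (- \<tau> (y s)) *\<^sub>R u" by (subst ys[OF that]) simp
      finally show ?thesis using u0 by (simp only: scaleR_cancel_right) simp
    qed
    \<comment> \<open>Inversion permutes \<open>S\<close>, so the odd coefficients sum to 0, whereas
      the sum of the \<open>y s\<close> is \<open>u\<close> itself.\<close>
    have "(\<Sum>s\<in>S. \<tau> (y s)) = (\<Sum>s\<in>S. \<tau> (y (inv s)))"
      by (rule sum.reindex_bij_witness[of _ "\<lambda>s. inv s" "\<lambda>s. inv s"]) (use S in auto)
    also have "\<dots> = - (\<Sum>s\<in>S. \<tau> (y s))" by (simp add: odd sum_negf)
    finally have "(\<Sum>s\<in>S. \<tau> (y s)) = 0" by simp
    moreover have "u = (\<Sum>s\<in>S. \<tau> (y s)) *\<^sub>R u"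
      unfolding scaleR_sum_left using ys by (simp add: u_def[symmetric] cong: sum.cong)
    ultimately show False using u0 by simp
  qed
  moreover have "(\<Sum>s\<in>S. p (y s)) = 0"
    using linear_sum[OF p_lin, of y S] p_u by (simp add: u_def)
  ultimately show ?thesis using coc S(2) by blast
qed

text \<open>\<open>f\<close> is the orbit map of the origin. By the cocycle identity, its average
  over the neighbours of \<open>x\<close> differs from \<open>f x\<close> by the image of a multiple
  of the vanishing sum of \<open>y\<close> over \<open>S\<close>.\<close>

lemma harmonic_l2_action:
  assumes S: "S \<noteq> {}" "finite S" "S \<subseteq> carrier G"
    and cnt: "countable (carrier G)" and nz: "\<exists>g\<in>carrier G. y g \<noteq> 0"
    and sum0: "(\<Sum>s\<in>S. y s) = 0"
  shows "\<exists>(\<rho>' :: 'a \<Rightarrow> (nat \<Rightarrow> real) \<Rightarrow> (nat \<Rightarrow> real)) A' b' (f :: 'a \<Rightarrow> nat \<Rightarrow> real).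
           (\<forall>\<gamma>\<in>carrier G. l2_linear (A' \<gamma>) \<and> l2_bounded (A' \<gamma>) \<and> b' \<gamma> \<in> l2)
         \<and> (\<forall>\<gamma>\<in>carrier G. \<forall>v\<in>l2. \<rho>' \<gamma> v = (\<lambda>n. A' \<gamma> v n + b' \<gamma> n))
         \<and> (\<forall>v\<in>l2. \<rho>' \<one> v = v)
         \<and> (\<forall>\<gamma>\<in>carrier G. \<forall>\<eta>\<in>carrier G. \<forall>v\<in>l2. \<rho>' (\<gamma> \<otimes> \<eta>) v = \<rho>' \<gamma> (\<rho>' \<eta> v))
         \<and> (\<forall>\<gamma>\<in>carrier G. l2_opnorm (A' \<gamma>) \<le> K \<gamma>)
         \<and> (\<forall>x\<in>carrier G. f x \<in> l2)
         \<and> (\<forall>\<gamma>\<in>carrier G. \<forall>x\<in>carrier G. f (\<gamma> \<otimes> x) = \<rho>' \<gamma> (f x))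
         \<and> (\<forall>x\<in>carrier G. (\<lambda>n. (\<Sum>s\<in>S. f (x \<otimes> s) n) / real (card S)) = f x)
         \<and> (\<exists>x\<in>carrier G. \<exists>y\<in>carrier G. f x \<noteq> f y)"
proof -
  obtain L F where L_bl: "\<And>\<gamma>. \<gamma> \<in> carrier G \<Longrightarrow> bounded_linear (L \<gamma>)"
    and L_norm: "\<And>\<gamma> x. \<gamma> \<in> carrier G \<Longrightarrow> norm (L \<gamma> x) \<le> K \<gamma> * norm x"
    and L_one: "\<And>x. L \<one> x = x"
    and L_mult: "\<And>\<gamma> \<eta> x. \<gamma> \<in> carrier G \<Longrightarrow> \<eta> \<in> carrier G \<Longrightarrow> L (\<gamma> \<otimes> \<eta>) x = L \<gamma> (L \<eta> x)"
    and F_lin: "linear F"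
    and F_T: "\<And>\<gamma> x. \<gamma> \<in> carrier G \<Longrightarrow> x \<in> V \<Longrightarrow> F (T \<gamma> x) = L \<gamma> (F x)"
    and F_norm: "\<And>x. x \<in> V \<Longrightarrow> norm (F x :: ell2) = norm x"
    using realisation_on_l2[OF cnt nz] by (elim exE conjE) (rule that, blast+)
  have yV: "y g \<in> V" if "g \<in> carrier G" for g
    using that by (intro span_base) auto
  have cocycle: "F (y (\<gamma> \<otimes> x)) = L \<gamma> (F (y x)) + F (y \<gamma>)" if "\<gamma> \<in> carrier G" "x \<in> carrier G" for \<gamma> x
  proof -
    have "y (\<gamma> \<otimes> x) = T \<gamma> (y x) + y \<gamma>" using that by (simp add: T_cocycle)
    then show ?thesis using that F_T[OF that(1) yV[OF that(2)]] by (simp add: linear_add[OF F_lin])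
  qed
  define A' where "A' \<gamma> v = coord (L \<gamma> (Abs_ell2 v))" for \<gamma> v
  define f where "f g = coord (F (y g))" for g
  define \<rho>' where "\<rho>' \<gamma> v = coord (L \<gamma> (Abs_ell2 v) + F (y \<gamma>))" for \<gamma> v
  have Abs_coord: "coord (Abs_ell2 v) = v" if "v \<in> l2" for v
    using that by (rule Abs_ell2_inverse)
  have l2_norm_Abs: "l2_norm v = norm (Abs_ell2 v)" if "v \<in> l2" for v
    using l2_norm_coord[of "Abs_ell2 v"] Abs_coord[OF that] by simp
  have A'_norm: "l2_norm (A' \<gamma> v) \<le> K \<gamma> * l2_norm v" if "\<gamma> \<in> carrier G" "v \<in> l2" for \<gamma> v
    using L_norm[OF that(1)] by (simp add: A'_def l2_norm_coord l2_norm_Abs[OF that(2)])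
  have A'_linear: "l2_linear (A' \<gamma>)" if "\<gamma> \<in> carrier G" for \<gamma>
  proof -
    have add: "Abs_ell2 (\<lambda>n. v n + w n) = Abs_ell2 v + Abs_ell2 w" if "v \<in> l2" "w \<in> l2" for v w
      using that by (intro ell2_eqI) (simp add: Abs_coord l2_add)
    have scale: "Abs_ell2 (\<lambda>n. c * v n) = c *\<^sub>R Abs_ell2 v" if "v \<in> l2" for c v
      using that by (intro ell2_eqI) (simp add: Abs_coord l2_scale)
    show ?thesis
      using bounded_linear.linear[OF L_bl[OF that]]
      by (auto simp: l2_linear_def A'_def coord add scale linear_add linear_scale fun_eq_iff)
  qed
  have opnorm: "l2_opnorm (A' \<gamma>) \<le> K \<gamma>" if "\<gamma> \<in> carrier G" for \<gamma>
    unfolding l2_opnorm_def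
  proof (rule cSup_least)
    show "{l2_norm (A' \<gamma> v) |v. v \<in> l2 \<and> l2_norm v \<le> 1} \<noteq> {}"
      using l2_zero by (auto intro!: exI[of _ "\<lambda>n. 0"] simp: l2_norm_def)
    fix r assume "r \<in> {l2_norm (A' \<gamma> v) |v. v \<in> l2 \<and> l2_norm v \<le> 1}"
    then obtain v where v: "r = l2_norm (A' \<gamma> v)" "v \<in> l2" "l2_norm v \<le> 1" by blast
    have "K \<gamma> * l2_norm v \<le> K \<gamma>" using mult_left_mono[OF v(3) K_nonneg[OF that]] by simp
    then show "r \<le> K \<gamma>" using A'_norm[OF that v(2)] v(1) by linarith
  qed
  have equivariant: "f (\<gamma> \<otimes> x) = \<rho>' \<gamma> (f x)" if "\<gamma> \<in> carrier G" "x \<in> carrier G" for \<gamma> x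
    by (simp add: f_def \<rho>'_def coord_inverse cocycle[OF that])
  have action: "\<rho>' (\<gamma> \<otimes> \<eta>) v = \<rho>' \<gamma> (\<rho>' \<eta> v)" if "\<gamma> \<in> carrier G" "\<eta> \<in> carrier G" for \<gamma> \<eta> v
    using linear_add[OF bounded_linear.linear[OF L_bl[OF that(1)]]]
    by (simp add: \<rho>'_def coord_inverse cocycle[OF that] L_mult[OF that] add.assoc)
  have one: "\<rho>' \<one> v = v" if "v \<in> l2" for v
    using that by (simp add: \<rho>'_def L_one y_one linear_0[OF F_lin] Abs_coord)
  have harmonic: "(\<lambda>n. (\<Sum>s\<in>S. f (x \<otimes> s) n) / real (card S)) = f x" if x: "x \<in> carrier G" for x
  proof -
    have "(\<Sum>s\<in>S. F (y (x \<otimes> s))) = (\<Sum>s\<in>S. L x (F (y s)) + F (y x))"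
      using S(3) x by (intro sum.cong) (auto intro!: cocycle)
    also have "\<dots> = L x (F (\<Sum>s\<in>S. y s)) + real (card S) *\<^sub>R F (y x)"
      by (simp only: linear_sum[OF bounded_linear.linear[OF L_bl[OF x]]] linear_sum[OF F_lin]
          sum.distrib sum_constant_scaleR)
    also have "\<dots> = real (card S) *\<^sub>R F (y x)"
      using linear_0[OF bounded_linear.linear[OF L_bl[OF x]]] by (simp add: sum0 linear_0[OF F_lin])
    finally have "(\<Sum>s\<in>S. f (x \<otimes> s) n) = real (card S) * f x n" for n
      by (simp add: f_def coord_sum[symmetric])
    moreover have "real (card S) \<noteq> 0" using S by auto
    ultimately show ?thesis by simp
  qed
  have nonconst: "\<exists>x\<in>carrier G. \<exists>z\<in>carrier G. f x \<noteq> f z"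
  proof -
    obtain g where g: "g \<in> carrier G" "y g \<noteq> 0" using nz by blast
    then have "F (y g) \<noteq> F (y \<one>)"
      using F_norm[OF yV[OF g(1)]] by (auto simp: y_one linear_0[OF F_lin])
    then have "f g \<noteq> f \<one>" by (simp add: f_def coord_inject)
    then show ?thesis using g(1) by blast
  qed
  show ?thesis
    by (rule exI[of _ \<rho>'], rule exI[of _ A'], rule exI[of _ f], rule exI[of _ f])
      (use A'_linear A'_norm opnorm equivariant action one harmonic nonconst in
        \<open>auto simp: l2_bounded_def f_def \<rho>'_def A'_def coord fun_eq_iff\<close>)
qed

end

section \<open>Averaging the inner product along the random walk\<close>

text \<open>The norm bound \<open>K\<close> enters through two features: it is constant on conjugacy
  classes, and its growth \<open>c\<close> along words is square-summable against every geometric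
  weight.\<close>

locale conj_bounded_rep = group G for G (structure) +
  fixes S :: "'a set" and A :: "'a \<Rightarrow> 'h::{real_inner, complete_space} \<Rightarrow> 'h" and K :: "'a \<Rightarrow> real" and c :: "nat \<Rightarrow> real"
  assumes S_fin: "finite S" and S_ne: "S \<noteq> {}" and S_sub: "S \<subseteq> carrier G"
    and A_linear: "\<gamma> \<in> carrier G \<Longrightarrow> linear (A \<gamma>)"
    and A_one: "A \<one> v = v"
    and A_mult: "\<gamma> \<in> carrier G \<Longrightarrow> \<eta> \<in> carrier G \<Longrightarrow> A (\<gamma> \<otimes> \<eta>) v = A \<gamma> (A \<eta> v)"
    and A_bound: "\<gamma> \<in> carrier G \<Longrightarrow> norm (A \<gamma> v) \<le> K \<gamma> * norm v"
    and K_conj: "\<gamma> \<in> carrier G \<Longrightarrow> h \<in> carrier G \<Longrightarrow> K (h \<otimes> \<gamma> \<otimes> inv h) = K \<gamma>"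
    and K_growth: "set ws \<subseteq> S \<Longrightarrow> K (foldr (\<otimes>) ws \<one>) \<le> c (length ws)"
    and c_summable: "0 < r \<Longrightarrow> r < 1 \<Longrightarrow> summable (\<lambda>k. r ^ k * (c k)\<^sup>2)"
begin

lemma card_S_pos: "real (card S) > 0"
  using S_fin S_ne by (simp add: card_gt_0_iff)

text \<open>The expected inner product of \<open>v\<close> and \<open>w\<close> moved by a product
  of \<open>k\<close> independent uniform elements of \<open>S\<close>. The recursion splits off the
  factor next to the vector, so averaging the form over \<open>S\<close> raises \<open>k\<close> by
  one.\<close>

primrec walk_form :: "nat \<Rightarrow> 'h \<Rightarrow> 'h \<Rightarrow> real" where
  "walk_form 0 v w = v \<bullet> w"
| "walk_form (Suc k) v w = (\<Sum>s\<in>S. walk_form k (A s v) (A s w)) / real (card S)"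

lemma psd_walk_form: "psd_form (walk_form k)"
proof (induction k)
  case 0
  then show ?case
    using inner.psd_form_axioms[where 'a = 'h] by simp
next
  case (Suc k)
  interpret psd_form "walk_form k" by (rule Suc)
  have lin: "linear (A s)" if "s \<in> S" for s
    using that S_sub by (auto intro: A_linear)
  show ?case
  proof
    fix x y z r
    show "walk_form (Suc k) (x + y) z = walk_form (Suc k) x z + walk_form (Suc k) y z"
      by (simp add: linear_add[OF lin] add_left sum.distrib add_divide_distrib)
    show "walk_form (Suc k) (r *\<^sub>R x) z = r * walk_form (Suc k) x z"
      by (simp add: linear_scale[OF lin] scale_left sum_distrib_left)
    show "walk_form (Suc k) x y = walk_form (Suc k) y x"
      using sym by simp
    show "0 \<le> walk_form (Suc k) x x"
      by (simp add: sum_nonneg nonneg)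
  qed
qed

lemma foldr_closed: "set ws \<subseteq> S \<Longrightarrow> foldr (\<otimes>) ws \<one> \<in> carrier G"
  using S_sub by (induction ws) auto

lemma average_mono:
  "(\<And>s. s \<in> S \<Longrightarrow> f s \<le> M) \<Longrightarrow> (\<Sum>s\<in>S. f s) / real (card S) \<le> M" for M :: real
  using sum_bounded_above[of S f M] card_S_pos by (simp add: field_simps)

text \<open>The word already applied is carried along in the induction, so that
  \<open>K_growth\<close> is used once for the whole word; bounds multiplied letter by letter would
  grow exponentially.\<close>

lemma walk_form_word_le:
  "set ws \<subseteq> S \<Longrightarrow>
    walk_form k (A (foldr (\<otimes>) ws \<one>) v) (A (foldr (\<otimes>) ws \<one>) v) \<le> (c (k + length ws))\<^sup>2 * (norm v)\<^sup>2"
proof (induction k arbitrary: ws)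
  case 0
  let ?h = "foldr (\<otimes>) ws \<one>"
  have "norm (A ?h v) \<le> K ?h * norm v"
    using 0 by (intro A_bound foldr_closed)
  also have "\<dots> \<le> c (length ws) * norm v"
    using 0 by (intro mult_right_mono K_growth) auto
  finally have "(norm (A ?h v))\<^sup>2 \<le> (c (length ws) * norm v)\<^sup>2"
    by (intro power_mono) auto
  then show ?case by (simp add: power2_norm_eq_inner power_mult_distrib)
next
  case (Suc k)
  let ?h = "foldr (\<otimes>) ws \<one>"
  have "walk_form k (A s (A ?h v)) (A s (A ?h v)) \<le> (c (Suc k + length ws))\<^sup>2 * (norm v)\<^sup>2" if "s \<in> S" for s
    using Suc.IH[of "s # ws"] Suc.prems that S_sub A_mult[of s ?h v] foldr_closed[of ws] by auto
  then show ?case by (simp add: average_mono)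
qed

lemma walk_form_le: "walk_form k v v \<le> (c k)\<^sup>2 * (norm v)\<^sup>2"
  using walk_form_word_le[of "[]" k v] by (simp add: A_one)

text \<open>The bound on \<open>A \<gamma>\<close> depends only on the conjugacy class of \<open>\<gamma>\<close>, so it survives the change of norm
  \<open>v \<mapsto> \<parallel>A h v\<parallel>\<close>, because \<open>A h (A \<gamma> v) = A (h \<gamma> h\<inverse>) (A h v)\<close>.\<close>

lemma walk_form_A_le:
  assumes \<gamma>: "\<gamma> \<in> carrier G"
  shows "h \<in> carrier G \<Longrightarrow>
    walk_form k (A h (A \<gamma> v)) (A h (A \<gamma> v)) \<le> (K \<gamma>)\<^sup>2 * walk_form k (A h v) (A h v)"
proof (induction k arbitrary: h)
  case (0 h)
  have "A h (A \<gamma> v) = A (h \<otimes> \<gamma> \<otimes> inv h) (A h v)"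
    using 0 \<gamma> by (simp add: A_mult[symmetric] m_assoc)
  then have "norm (A h (A \<gamma> v)) \<le> K \<gamma> * norm (A h v)"
    using A_bound[of "h \<otimes> \<gamma> \<otimes> inv h" "A h v"] 0 \<gamma> by (simp add: K_conj)
  then have "(norm (A h (A \<gamma> v)))\<^sup>2 \<le> (K \<gamma> * norm (A h v))\<^sup>2"
    by (intro power_mono) auto
  then show ?case by (simp add: power2_norm_eq_inner power_mult_distrib)
next
  case (Suc k h)
  have "walk_form k (A s (A h (A \<gamma> v))) (A s (A h (A \<gamma> v)))
      \<le> (K \<gamma>)\<^sup>2 * walk_form k (A s (A h v)) (A s (A h v))" if "s \<in> S" for s
    using Suc.IH[of "s \<otimes> h"] Suc.prems that S_sub by (auto simp: A_mult)
  then show ?case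
    using card_S_pos by (simp add: divide_right_mono sum_mono sum_distrib_left)
qed

section \<open>The geometrically weighted sum of the walk forms\<close>

definition mean_form :: "real \<Rightarrow> 'h \<Rightarrow> 'h \<Rightarrow> real" where
  "mean_form r v w = suminf (\<lambda>k. r ^ k * walk_form k v w)"

context
  fixes r :: real
  assumes r: "0 < r" "r < 1"
begin

text \<open>\<open>Cauchy_Schwarz\<close> for each \<open>walk_form k\<close> reduces mixed terms to
  the diagonal estimate \<open>walk_form_le\<close>.\<close>

lemma mean_form_summable: "summable (\<lambda>k. r ^ k * walk_form k v w)"
proof (rule summable_comparison_test')
  show "summable (\<lambda>k. (norm v * norm w) * (r ^ k * (c k)\<^sup>2))"
    by (intro summable_mult c_summable r)
  fix k
  interpret psd_form "walk_form k" by (rule psd_walk_form)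
  have "(walk_form k v w)\<^sup>2 \<le> walk_form k v v * walk_form k w w" by (rule Cauchy_Schwarz)
  also have "\<dots> \<le> ((c k)\<^sup>2 * (norm v)\<^sup>2) * ((c k)\<^sup>2 * (norm w)\<^sup>2)"
    by (intro mult_mono walk_form_le nonneg) auto
  also have "\<dots> = ((c k)\<^sup>2 * (norm v * norm w))\<^sup>2" by (simp add: power2_eq_square)
  finally have "\<bar>walk_form k v w\<bar> \<le> (c k)\<^sup>2 * (norm v * norm w)"
    by (simp add: abs_le_square_iff[symmetric])
  then have "r ^ k * \<bar>walk_form k v w\<bar> \<le> r ^ k * ((c k)\<^sup>2 * (norm v * norm w))"
    using r by (intro mult_left_mono) auto
  then show "norm (r ^ k * walk_form k v w) \<le> (norm v * norm w) * (r ^ k * (c k)\<^sup>2)"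
    using r by (simp add: abs_mult mult_ac)
qed

lemma psd_mean_form: "psd_form (mean_form r)"
proof
  fix x y z and a :: real
  show "mean_form r (x + y) z = mean_form r x z + mean_form r y z"
    by (simp add: mean_form_def psd_form.add_left[OF psd_walk_form] distrib_left suminf_add mean_form_summable)
  show "mean_form r (a *\<^sub>R x) z = a * mean_form r x z"
    using suminf_mult[OF mean_form_summable, of a x z]
    by (simp add: mean_form_def psd_form.scale_left[OF psd_walk_form] mult_ac)
  show "mean_form r x y = mean_form r y x"
    unfolding mean_form_def using psd_form.sym[OF psd_walk_form] by metis
  show "0 \<le> mean_form r x x"
    unfolding mean_form_def using r
    by (intro suminf_nonneg mean_form_summable mult_nonneg_nonneg psd_form.nonneg[OF psd_walk_form]) auto
qed

text \<open>The term \<open>k = 0\<close> is the original inner product. Decay in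
  \<open>mean_form\<close> thus gives convergence in the complete norm.\<close>

lemma mean_form_ge: "(norm v)\<^sup>2 \<le> mean_form r v v"
proof -
  have "(\<Sum>k\<in>{0}. r ^ k * walk_form k v v) \<le> mean_form r v v"
    unfolding mean_form_def using r
    by (intro sum_le_suminf mean_form_summable) (auto intro!: mult_nonneg_nonneg psd_form.nonneg[OF psd_walk_form])
  then show ?thesis by (simp add: power2_norm_eq_inner)
qed

lemma mean_form_A_le:
  assumes "\<gamma> \<in> carrier G"
  shows "mean_form r (A \<gamma> v) (A \<gamma> v) \<le> (K \<gamma>)\<^sup>2 * mean_form r v v"
proof -
  have "r ^ k * walk_form k (A \<gamma> v) (A \<gamma> v) \<le> (K \<gamma>)\<^sup>2 * (r ^ k * walk_form k v v)" for k
  proof -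
    have "r ^ k * walk_form k (A \<gamma> v) (A \<gamma> v) \<le> r ^ k * ((K \<gamma>)\<^sup>2 * walk_form k v v)"
      using walk_form_A_le[OF assms, of \<one> k v] r by (intro mult_left_mono) (auto simp: A_one)
    then show ?thesis by (simp add: mult_ac)
  qed
  then show ?thesis
    unfolding mean_form_def suminf_mult[OF mean_form_summable, symmetric]
    by (intro suminf_le mean_form_summable summable_mult)
qed

text \<open>Averaging over \<open>S\<close> shifts the walk by one step, so \<open>r\<close> times
  the average is the series without its term \<open>k = 0\<close>.\<close>

lemma mean_form_average_le:
  "(\<Sum>s\<in>S. mean_form r (A s v) (A s v)) \<le> real (card S) * (mean_form r v v / r)"
proof -
  have "r * ((\<Sum>s\<in>S. mean_form r (A s v) (A s v)) / real (card S)) =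
      suminf (\<lambda>k. r ^ Suc k * walk_form (Suc k) v v)"
  proof -
    have "(\<lambda>k. r ^ k * walk_form k (A s v) (A s v)) sums mean_form r (A s v) (A s v)" for s
      unfolding mean_form_def by (rule summable_sums[OF mean_form_summable])
    then have "(\<lambda>k. r * ((\<Sum>s\<in>S. r ^ k * walk_form k (A s v) (A s v)) / real (card S))) sums
        (r * ((\<Sum>s\<in>S. mean_form r (A s v) (A s v)) / real (card S)))"
      by (intro sums_mult sums_divide sums_sum)
    moreover have "(\<lambda>k. r * ((\<Sum>s\<in>S. r ^ k * walk_form k (A s v) (A s v)) / real (card S))) =
        (\<lambda>k. r ^ Suc k * walk_form (Suc k) v v)"
      by (simp add: sum_distrib_left[symmetric] mult.assoc)
    ultimately show ?thesis by (simp only: sums_iff)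
  qed
  also have "\<dots> = mean_form r v v - v \<bullet> v"
    using suminf_split_head[OF mean_form_summable[of v v]] by (simp only: mean_form_def) simp
  also have "\<dots> \<le> mean_form r v v" by simp
  finally show ?thesis using r card_S_pos by (simp add: field_simps)
qed

end

end

section \<open>Almost harmonic points\<close>

context psd_form
begin

text \<open>Expanding the assumed bound controls the cross term of \<open>u\<close> with the mean
  displacement, and convexity controls the square of that mean. In a full step the two contributions
  of the squared displacements would cancel; the half step keeps a quarter of their mean as a
  gain.\<close>

lemma lazy_average_le:
  assumes F: "finite F" "F \<noteq> {}"
    and q: "(\<Sum>s\<in>F. B (a s) (a s)) \<le> card F * (q * B u u)" and "1 \<le> q"
  shows "B (u + (1/2) *\<^sub>R ((\<Sum>s\<in>F. a s - u) /\<^sub>R card F)) (u + (1/2) *\<^sub>R ((\<Sum>s\<in>F. a s - u) /\<^sub>R card F))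
    \<le> q * B u u - (\<Sum>s\<in>F. B (a s - u) (a s - u)) / (4 * card F)"
proof -
  let ?d = "(\<Sum>s\<in>F. a s - u) /\<^sub>R card F"
  let ?D = "(\<Sum>s\<in>F. B (a s - u) (a s - u))"
  have n: "real (card F) > 0" using F by (simp add: card_gt_0_iff)
  have "(\<Sum>s\<in>F. B u (a s - u)) = card F * B u ?d"
    using n by (simp add: scale_right sum_right)
  moreover have "B (a s) (a s) = B u u + 2 * B u (a s - u) + B (a s - u) (a s - u)" for s
    by (simp add: diff_left diff_right sym[of "a s" u])
  then have "(\<Sum>s\<in>F. B (a s) (a s)) = card F * B u u + 2 * (\<Sum>s\<in>F. B u (a s - u)) + ?D"
    by (simp only: sum.distrib sum_distrib_left[symmetric]) simp
  ultimately have "card F * B u u + 2 * (card F * B u ?d) + ?D \<le> card F * (q * B u u)"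
    using q by simp
  then have ud: "2 * B u ?d \<le> (q - 1) * B u u - ?D / card F"
    using n by (simp add: field_simps)
  have "B (u + (1/2) *\<^sub>R ?d) (u + (1/2) *\<^sub>R ?d) = B u u + B u ?d + B ?d ?d / 4"
    using sym[of ?d u] by (simp only: add_left add_right scale_left[of "1/2"] scale_right[of _ "1/2"]) (simp add: field_simps)
  also have "\<dots> \<le> B u u + ((q - 1) * B u u - ?D / card F) / 2 + ?D / card F / 4"
  proof -
    have aux: "z + a + b / 4 \<le> z + (p - d) / 2 + d / 4" if "2 * a \<le> p - d" "b \<le> d" for a b p d z :: real
      using that by (simp add: field_simps)
    show ?thesis by (rule aux[OF ud average_le[OF F]])
  qed
  also have "\<dots> \<le> q * B u u - ?D / card F / 4"
    using mult_right_mono[OF \<open>1 \<le> q\<close> nonneg[of u]] by (simp add: field_simps)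
  finally show ?thesis by simp
qed

end

text \<open>The sort \<open>{real_inner, complete_space}\<close> is not a subsort of \<open>banach\<close>, which rules out
  \<open>summable_norm_cancel\<close>.\<close>

lemma absolutely_convergent_complete:
  fixes f :: "nat \<Rightarrow> 'h::{real_normed_vector, complete_space}"
  assumes "summable (\<lambda>k. norm (f k))"
  shows "convergent (\<lambda>k. \<Sum>i<k. f i)"
proof (rule Cauchy_convergent, rule metric_CauchyI)
  fix e :: real assume "e > 0"
  have le: "dist (\<Sum>i<m. f i) (\<Sum>i<n. f i) \<le> dist (\<Sum>i<m. norm (f i)) (\<Sum>i<n. norm (f i))" if "n \<le> m" for m n
  proof -
    have "(\<Sum>i<m. f i) - (\<Sum>i<n. f i) = (\<Sum>i=n..<m. f i)"
      "(\<Sum>i<m. norm (f i)) - (\<Sum>i<n. norm (f i)) = (\<Sum>i=n..<m. norm (f i))"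
      using that by (simp_all add: lessThan_atLeast0 sum_diff_nat_ivl)
    then show ?thesis by (simp add: dist_norm norm_sum sum_nonneg)
  qed
  have le': "dist (\<Sum>i<m. f i) (\<Sum>i<n. f i) \<le> dist (\<Sum>i<m. norm (f i)) (\<Sum>i<n. norm (f i))" for m n
    using le[of n m] le[of m n] by (cases "n \<le> m") (simp_all add: dist_commute)
  have "Cauchy (\<lambda>k. \<Sum>i<k. norm (f i))"
    using assms by (simp add: summable_iff_convergent convergent_Cauchy)
  then obtain M where "\<forall>m\<ge>M. \<forall>n\<ge>M. dist (\<Sum>i<m. norm (f i)) (\<Sum>i<n. norm (f i)) < e"
    using \<open>e > 0\<close> metric_CauchyD by blast
  then have "\<forall>m\<ge>M. \<forall>n\<ge>M. dist (\<Sum>i<m. f i) (\<Sum>i<n. f i) < e"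
    using le' order_le_less_trans by blast
  then show "\<exists>M. \<forall>m\<ge>M. \<forall>n\<ge>M. dist (\<Sum>i<m. f i) (\<Sum>i<n. f i) < e" by blast
qed

text \<open>Each lazy step lowers \<open>B\<close> on the mean displacement \<open>u\<close> by a
  multiple of the squared displacements of \<open>u\<close>. The gap turns this into a gain
  exceeding the growth factor \<open>1 + \<epsilon> / 8\<close>.\<close>

lemma fixed_point_of_gap:
  fixes B :: "'h::{real_inner, complete_space} \<Rightarrow> 'h \<Rightarrow> real"
  assumes psd: "psd_form B" and F: "finite F" "F \<noteq> {}"
    and lin: "\<And>s. s \<in> F \<Longrightarrow> linear (A s)"
    and aff: "\<And>s v. s \<in> F \<Longrightarrow> \<rho> s v = A s v + b s"
    and cont: "\<And>s. s \<in> F \<Longrightarrow> continuous_on UNIV (\<rho> s)"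
    and norm_le: "\<And>v. (norm v)\<^sup>2 \<le> B v v"
    and avg: "\<And>v. (\<Sum>s\<in>F. B (A s v) (A s v)) \<le> card F * ((1 + \<epsilon> / 8) * B v v)"
    and \<epsilon>: "0 < \<epsilon>" "\<epsilon> \<le> 1"
    and gap: "\<And>v u. u = (\<Sum>s\<in>F. \<rho> s v - v) /\<^sub>R card F \<Longrightarrow>
      \<epsilon> * (\<Sum>s\<in>F. B (\<rho> s v - v) (\<rho> s v - v)) \<le> (\<Sum>s\<in>F. B (A s u - u) (A s u - u))"
  shows "\<exists>w. \<forall>s\<in>F. \<rho> s w = w"
proof -
  interpret psd_form B by (rule psd)
  have n: "real (card F) > 0" using F by (simp add: card_gt_0_iff)
  define u where "u v = (\<Sum>s\<in>F. \<rho> s v - v) /\<^sub>R card F" for v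
  define D where "D v = (\<Sum>s\<in>F. B (A s (u v) - u v) (A s (u v) - u v))" for v
  define x where "x k = ((\<lambda>v. v + (1/2) *\<^sub>R u v) ^^ k) 0" for k
  have x_Suc: "x (Suc k) = x k + (1/2) *\<^sub>R u (x k)" for k by (simp add: x_def)
  \<comment> \<open>As the \<open>\<rho> s\<close> are affine, the new mean displacement is the lazy
    average of the old one under the linear parts.\<close>
  have u_step: "u (v + (1/2) *\<^sub>R u v) = u v + (1/2) *\<^sub>R ((\<Sum>s\<in>F. A s (u v) - u v) /\<^sub>R card F)" for v
  proof -
    have "\<rho> s (v + (1/2) *\<^sub>R u v) - (v + (1/2) *\<^sub>R u v) = (\<rho> s v - v) + (1/2) *\<^sub>R (A s (u v) - u v)" if "s \<in> F" for s
      using that by (simp add: aff linear_add[OF lin] linear_scale[OF lin] scaleR_diff_right)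
    then have "(\<Sum>s\<in>F. \<rho> s (v + (1/2) *\<^sub>R u v) - (v + (1/2) *\<^sub>R u v)) =
        (\<Sum>s\<in>F. (\<rho> s v - v) + (1/2) *\<^sub>R (A s (u v) - u v))"
      by (rule sum.cong[OF refl])
    also have "\<dots> = (\<Sum>s\<in>F. \<rho> s v - v) + (1/2) *\<^sub>R (\<Sum>s\<in>F. A s (u v) - u v)"
      by (simp only: sum.distrib scaleR_sum_right)
    finally show ?thesis
      by (subst u_def, simp only: scaleR_add_right u_def[of v, symmetric] scaleR_left_commute[of _ "1/2"])
  qed
  have step: "B (u (v + (1/2) *\<^sub>R u v)) (u (v + (1/2) *\<^sub>R u v)) \<le> (1 + \<epsilon> / 8) * B (u v) (u v) - D v / (4 * card F)" for v
    unfolding u_step D_def using avg[of "u v"] \<epsilon> by (intro lazy_average_le F) auto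
  have D_ge: "\<epsilon> * (\<Sum>s\<in>F. B (\<rho> s v - v) (\<rho> s v - v)) \<le> D v" for v
    unfolding D_def by (rule gap) (rule u_def)
  \<comment> \<open>By convexity and the gap, \<open>D\<close> is at least
    \<open>\<epsilon> * card F\<close> times \<open>B\<close> on \<open>u\<close>, so a gain of
    \<open>\<epsilon> / 4\<close> meets a loss of \<open>\<epsilon> / 8\<close>.\<close>
  have decay: "B (u (x (Suc k))) (u (x (Suc k))) \<le> (1 - \<epsilon> / 8) * B (u (x k)) (u (x k))" for k
  proof -
    have "B (u (x k)) (u (x k)) \<le> (\<Sum>s\<in>F. B (\<rho> s (x k) - x k) (\<rho> s (x k) - x k)) / card F"
      unfolding u_def by (rule average_le[OF F])
    then have "\<epsilon> * (card F * B (u (x k)) (u (x k))) \<le> \<epsilon> * (\<Sum>s\<in>F. B (\<rho> s (x k) - x k) (\<rho> s (x k) - x k))"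
      using n \<epsilon> by (intro mult_left_mono) (auto simp: field_simps)
    also have "\<dots> \<le> D (x k)" by (rule D_ge)
    finally have "\<epsilon> * B (u (x k)) (u (x k)) / 4 \<le> D (x k) / (4 * card F)"
      using n by (simp add: field_simps)
    then show ?thesis
      using step[of "x k"] unfolding x_Suc distrib_right left_diff_distrib by linarith
  qed
  define q where "q = 1 - \<epsilon> / 8"
  have q: "0 < q" "q < 1" using \<epsilon> by (auto simp: q_def)
  define M where "M = B (u (x 0)) (u (x 0))"
  have geom: "B (u (x k)) (u (x k)) \<le> q ^ k * M" for k
  proof (induction k)
    case (Suc k)
    have "B (u (x (Suc k))) (u (x (Suc k))) \<le> q * B (u (x k)) (u (x k))"
      using decay[of k] by (simp add: q_def)
    also have "\<dots> \<le> q * (q ^ k * M)" using Suc q by (intro mult_left_mono) auto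
    finally show ?case by simp
  qed (simp add: M_def)
  have M0: "0 \<le> M" unfolding M_def by (rule nonneg)
  have "summable (\<lambda>k. norm ((1/2) *\<^sub>R u (x k)))"
  proof (rule summable_comparison_test')
    show "summable (\<lambda>k. sqrt M * sqrt q ^ k)"
      using q by (intro summable_mult summable_geometric) auto
    fix k
    have "(norm (u (x k)))\<^sup>2 \<le> q ^ k * M" using norm_le geom order_trans by blast
    then have "norm (u (x k)) \<le> sqrt (q ^ k * M)" by (rule real_le_rsqrt)
    then have "norm (u (x k)) \<le> sqrt M * sqrt q ^ k" by (simp add: real_sqrt_mult real_sqrt_power mult.commute)
    moreover have "norm (norm ((1/2) *\<^sub>R u (x k))) \<le> norm (u (x k))" by simp
    ultimately show "norm (norm ((1/2) *\<^sub>R u (x k))) \<le> sqrt M * sqrt q ^ k" by (rule order_trans[rotated])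
  qed
  then have "convergent (\<lambda>k. \<Sum>i<k. (1/2) *\<^sub>R u (x i))" by (rule absolutely_convergent_complete)
  moreover have "(\<Sum>i<k. (1/2) *\<^sub>R u (x i)) = x k" for k
    by (induction k) (simp_all add: x_Suc, simp add: x_def)
  ultimately obtain w where w: "x \<longlonglongrightarrow> w"
    by (auto simp: convergent_def)
  have "\<rho> s w = w" if s: "s \<in> F" for s
  proof -
    \<comment> \<open>The left side of \<open>step\<close> is nonnegative, so \<open>D\<close>
      decays along with \<open>B\<close> on \<open>u\<close>. By the gap every single displacement
      decays too, and continuity carries this to \<open>w\<close>.\<close>
    have bound: "(norm (\<rho> s (x k) - x k))\<^sup>2 \<le> (4 * card F * (1 + \<epsilon> / 8) * M / \<epsilon>) * q ^ k" for k
    proof -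
      have "(norm (\<rho> s (x k) - x k))\<^sup>2 \<le> B (\<rho> s (x k) - x k) (\<rho> s (x k) - x k)" by (rule norm_le)
      also have "\<dots> \<le> (\<Sum>s\<in>F. B (\<rho> s (x k) - x k) (\<rho> s (x k) - x k))"
        using F s by (intro member_le_sum nonneg) auto
      also have "\<dots> \<le> D (x k) / \<epsilon>" using D_ge[of "x k"] \<epsilon> by (simp add: field_simps)
      also have "\<dots> \<le> 4 * card F * ((1 + \<epsilon> / 8) * (q ^ k * M)) / \<epsilon>"
      proof (rule divide_right_mono)
        have "D (x k) / (4 * card F) \<le> (1 + \<epsilon> / 8) * B (u (x k)) (u (x k))"
          using step[of "x k"] nonneg[of "u (x k + (1/2) *\<^sub>R u (x k))"] by linarith
        also have "\<dots> \<le> (1 + \<epsilon> / 8) * (q ^ k * M)"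
          using \<epsilon> by (intro mult_left_mono geom) auto
        finally show "D (x k) \<le> 4 * card F * ((1 + \<epsilon> / 8) * (q ^ k * M))"
          using n by (simp add: field_simps)
      qed (use \<epsilon> in simp)
      finally show ?thesis by (simp add: mult_ac)
    qed
    have "isCont (\<rho> s) w"
      using cont[OF s] by (simp add: continuous_on_eq_continuous_at)
    then have "(\<lambda>k. (norm (\<rho> s (x k) - x k))\<^sup>2) \<longlonglongrightarrow> (norm (\<rho> s w - w))\<^sup>2"
      by (intro tendsto_intros w isCont_tendsto_compose[of w "\<rho> s"])
    moreover have "(\<lambda>k. (4 * card F * (1 + \<epsilon> / 8) * M / \<epsilon>) * q ^ k) \<longlonglongrightarrow> (4 * card F * (1 + \<epsilon> / 8) * M / \<epsilon>) * 0"
      using q by (intro tendsto_mult tendsto_const LIMSEQ_power_zero) auto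
    ultimately have "(norm (\<rho> s w - w))\<^sup>2 \<le> (4 * card F * (1 + \<epsilon> / 8) * M / \<epsilon>) * 0"
      by (rule LIMSEQ_le) (use bound in blast)
    then show ?thesis by simp
  qed
  then show ?thesis by blast
qed

section \<open>Limits of Gram matrices\<close>

text \<open>The forms change with \<open>n\<close>, so there is no common norm in which the vectors
  could converge. Their Gram-Schmidt coefficients are bounded entry by entry and converge along a
  diagonal subsequence; the limit rows are the vectors \<open>y g\<close>.\<close>

lemma gram_matrix_limit:
  fixes B :: "nat \<Rightarrow> 'h::real_vector \<Rightarrow> 'h \<Rightarrow> real" and z :: "nat \<Rightarrow> 'i \<Rightarrow> 'h"
  assumes psd: "\<And>n. psd_form (B n)" and cnt: "countable I"
    and bdd: "\<forall>g\<in>I. \<exists>D. \<forall>n. B n (z n g) (z n g) \<le> D"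
  shows "\<exists>r (y :: 'i \<Rightarrow> ell2). strict_mono (r :: nat \<Rightarrow> nat) \<and>
    (\<forall>g\<in>I. \<forall>h\<in>I. (\<lambda>n. B (r n) (z (r n) g) (z (r n) h)) \<longlonglongrightarrow> y g \<bullet> y h)"
proof (cases "I = {}")
  case True
  then show ?thesis using strict_mono_id by blast
next
  case False
  define v where "v n k = z n (from_nat_into I k)" for n k
  define e where "e n = psd_form.gram_schmidt (B n) (v n)" for n
  define a where "a n p = B n (v n (fst p)) (e n (snd p))" for n p
  have "\<exists>D. \<forall>n. B n (v n k) (v n k) \<le> D" for k
    unfolding v_def using bdd from_nat_into[OF False] by blast
  then obtain D where D: "\<And>n k. B n (v n k) (v n k) \<le> D k" by metis
  have D0: "0 \<le> D k" for k using D[of 0 k] psd_form.nonneg[OF psd] order_trans by blast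
  have a_bound: "\<bar>a n p\<bar> \<le> sqrt (D (fst p))" for n p
  proof -
    have "(a n p)\<^sup>2 \<le> D (fst p)"
      unfolding a_def e_def using psd_form.gram_schmidt_coeff_le[OF psd] D order_trans by blast
    then show ?thesis using real_le_rsqrt[of "\<bar>a n p\<bar>"] by simp
  qed
  \<comment> \<open>Rows are scaled to the common bound 1 used for the extraction; the summand 1
    keeps the divisor positive.\<close>
  have scaled_bound: "norm (a n p / (1 + sqrt (D (fst p)))) \<le> 1" for n p
    using a_bound[of n p] D0[of "fst p"] by (simp add: field_simps)
  obtain r where r: "strict_mono (r :: nat \<Rightarrow> nat)"
    and conv: "\<And>p. \<exists>l. (\<lambda>n. a (r n) p / (1 + sqrt (D (fst p)))) \<longlonglongrightarrow> l"
    using function_convergent_subsequence[of "UNIV :: (nat \<times> nat) set"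
        "\<lambda>n p. a n p / (1 + sqrt (D (fst p)))" 1] scaled_bound by auto
  have "\<exists>l. (\<lambda>n. a (r n) p) \<longlonglongrightarrow> l" for p
  proof -
    obtain l where "(\<lambda>n. a (r n) p / (1 + sqrt (D (fst p)))) \<longlonglongrightarrow> l" using conv by blast
    then have "(\<lambda>n. a (r n) p / (1 + sqrt (D (fst p))) * (1 + sqrt (D (fst p)))) \<longlonglongrightarrow> l * (1 + sqrt (D (fst p)))"
      by (intro tendsto_mult tendsto_const)
    moreover have "1 + sqrt (D (fst p)) \<noteq> 0" using D0[of "fst p"] real_sqrt_ge_zero[of "D (fst p)"] by linarith
    ultimately show ?thesis by auto
  qed
  then obtain l where l: "\<And>p. (\<lambda>n. a (r n) p) \<longlonglongrightarrow> l p" by metis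
  \<comment> \<open>Triangularity makes each limit row finitely supported, so it lies in
    \<open>ell2\<close> and its inner products are limits of finite sums.\<close>
  have l0: "l (k, i) = 0" if "k < i" for k i
  proof -
    have "a n (k, i) = 0" for n
      using psd_form.gram_schmidt_triangular[OF psd that] by (simp add: a_def e_def)
    then show ?thesis using l[of "(k, i)"] by (simp add: LIMSEQ_const_iff)
  qed
  define y' :: "nat \<Rightarrow> ell2" where "y' k = (\<Sum>i\<le>k. l (k, i) *\<^sub>R unit_vec i)" for k
  have coord_y': "coord (y' k) i = l (k, i)" for k i
    using l0[of k i] by (simp add: y'_def coord_sum coord_unit_vec if_distrib cong: if_cong)
  have lim: "(\<lambda>n. B (r n) (v (r n) j) (v (r n) k)) \<longlonglongrightarrow> y' j \<bullet> y' k" for j k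
  proof -
    have "B n (v n j) (v n k) = (\<Sum>i\<le>j. a n (j, i) * a n (k, i))" for n
      unfolding a_def e_def fst_conv snd_conv
      by (subst psd_form.gram_schmidt_expand_left[OF psd]) (simp add: psd_form.sym[OF psd])
    moreover have "(\<lambda>n. \<Sum>i\<le>j. a (r n) (j, i) * a (r n) (k, i)) \<longlonglongrightarrow> (\<Sum>i\<le>j. l (j, i) * l (k, i))"
      by (intro tendsto_sum tendsto_mult l)
    moreover have "y' j \<bullet> y' k = (\<Sum>i\<le>j. l (j, i) * l (k, i))"
      by (subst inner_commute, subst (2) y'_def)
        (simp add: inner_sum_right inner_unit_vec coord_y')
    ultimately show ?thesis by simp
  qed
  have "(\<lambda>n. B (r n) (z (r n) g) (z (r n) h)) \<longlonglongrightarrow> y' (to_nat_on I g) \<bullet> y' (to_nat_on I h)"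
    if "g \<in> I" "h \<in> I" for g h
    using lim[of "to_nat_on I g" "to_nat_on I h"] that cnt by (simp add: v_def)
  then show ?thesis using r by (intro exI[of _ r] exI[of _ "\<lambda>g. y' (to_nat_on I g)"]) auto
qed

text \<open>The graph of the linear correspondence between combinations of the approximating cocycles and the
  same combinations of their limit.\<close>

inductive limit_pair :: "(nat \<Rightarrow> 'i \<Rightarrow> 'h::real_vector) \<Rightarrow> ('i \<Rightarrow> 'v::real_vector) \<Rightarrow> 'i set \<Rightarrow> (nat \<Rightarrow> 'h) \<Rightarrow> 'v \<Rightarrow> bool"
  for z y I where
  gen: "g \<in> I \<Longrightarrow> limit_pair z y I (\<lambda>n. z n g) (y g)"
| zero: "limit_pair z y I (\<lambda>n. 0) 0"
| add: "limit_pair z y I v x \<Longrightarrow> limit_pair z y I v' x' \<Longrightarrow> limit_pair z y I (\<lambda>n. v n + v' n) (x + x')"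
| scale: "limit_pair z y I v x \<Longrightarrow> limit_pair z y I (\<lambda>n. c *\<^sub>R v n) (c *\<^sub>R x)"

lemma limit_pair_diff:
  assumes "limit_pair z y I v x" "limit_pair z y I v' x'"
  shows "limit_pair z y I (\<lambda>n. v n - v' n) (x - x')"
  using limit_pair.add[OF assms(1) limit_pair.scale[OF assms(2), of "-1"]] by simp

lemma limit_pair_sum:
  assumes "\<And>i. i \<in> F \<Longrightarrow> limit_pair z y I (v i) (x i)"
  shows "limit_pair z y I (\<lambda>n. \<Sum>i\<in>F. v i n) (\<Sum>i\<in>F. x i)"
  using assms by (induction F rule: infinite_finite_induct) (auto intro: limit_pair.zero limit_pair.add)

text \<open>Convergence on generators extends by bilinearity, one argument at a time.\<close>

lemma limit_pair_tendsto:
  assumes psd: "\<And>n. psd_form (B n)"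
    and conv: "\<And>g h. g \<in> I \<Longrightarrow> h \<in> I \<Longrightarrow> (\<lambda>n. B n (z n g) (z n h)) \<longlonglongrightarrow> y g \<bullet> (y h :: 'v::real_inner)"
    and v: "limit_pair z y I v x" and w: "limit_pair z y I w x'"
  shows "(\<lambda>n. B n (v n) (w n)) \<longlonglongrightarrow> x \<bullet> x'"
  using v
proof induction
  case (gen g)
  show ?case
    using w
  proof induction
    case (gen h)
    then show ?case using conv \<open>g \<in> I\<close> by blast
  next
    case zero
    then show ?case by (simp add: psd_form.zero_right[OF psd])
  next
    case add
    then show ?case by (simp add: psd_form.add_right[OF psd] inner_add_right tendsto_add)
  next
    case scale
    then show ?case by (simp add: psd_form.scale_right[OF psd] tendsto_mult_left)
  qed
next
  case zero
  then show ?case by (simp add: psd_form.zero_left[OF psd])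
next
  case add
  then show ?case by (simp add: psd_form.add_left[OF psd] inner_add_left tendsto_add)
next
  case scale
  then show ?case by (simp add: psd_form.scale_left[OF psd] tendsto_mult_left)
qed

text \<open>\<open>B_A\<close> passes to the limit, so a sequence with limit 0 has images with limit
  0. The limit operator is thus well defined on combinations of the \<open>y g\<close>, even if
  these become dependent in the limit.\<close>

lemma (in group) limit_cocycle:
  fixes B :: "nat \<Rightarrow> 'h::real_vector \<Rightarrow> 'h \<Rightarrow> real" and z :: "nat \<Rightarrow> 'a \<Rightarrow> 'h" and y :: "'a \<Rightarrow> 'v::real_inner"
  assumes psd: "\<And>n. psd_form (B n)"
    and conv: "\<And>g h. g \<in> carrier G \<Longrightarrow> h \<in> carrier G \<Longrightarrow> (\<lambda>n. B n (z n g) (z n h)) \<longlonglongrightarrow> y g \<bullet> y h"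
    and A_linear: "\<And>\<gamma>. \<gamma> \<in> carrier G \<Longrightarrow> linear (A \<gamma>)"
    and z_cocycle: "\<And>n \<gamma> g. \<gamma> \<in> carrier G \<Longrightarrow> g \<in> carrier G \<Longrightarrow> A \<gamma> (z n g) = z n (\<gamma> \<otimes> g) - z n \<gamma>"
    and z_one: "\<And>n. z n \<one> = 0"
    and B_A: "\<And>n \<gamma> v. \<gamma> \<in> carrier G \<Longrightarrow> B n (A \<gamma> v) (A \<gamma> v) \<le> (K \<gamma>)\<^sup>2 * B n v v"
    and K_nonneg: "\<And>\<gamma>. \<gamma> \<in> carrier G \<Longrightarrow> 0 \<le> K \<gamma>"
  shows "\<exists>T. bounded_cocycle G T y K \<and> (\<forall>\<gamma>\<in>carrier G. \<forall>v x. limit_pair z y (carrier G) v x \<longrightarrow>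
    limit_pair z y (carrier G) (\<lambda>n. A \<gamma> (v n)) (T \<gamma> x))"
proof -
  let ?L = "limit_pair z y (carrier G)"
  note lim = limit_pair_tendsto[OF psd conv]
  have image: "\<exists>x'. ?L (\<lambda>n. A \<gamma> (v n)) x'" if \<gamma>: "\<gamma> \<in> carrier G" and v: "?L v x" for \<gamma> v x
    using v
  proof induction
    case (gen g)
    have "?L (\<lambda>n. z n (\<gamma> \<otimes> g) - z n \<gamma>) (y (\<gamma> \<otimes> g) - y \<gamma>)"
      using gen \<gamma> by (intro limit_pair_diff limit_pair.gen) auto
    then show ?case using gen \<gamma> by (auto simp: z_cocycle)
  next
    case zero
    then show ?case using limit_pair.zero by (auto simp: linear_0[OF A_linear[OF \<gamma>]])
  next
    case add
    then show ?case using limit_pair.add by (fastforce simp: linear_add[OF A_linear[OF \<gamma>]])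
  next
    case scale
    then show ?case using limit_pair.scale by (fastforce simp: linear_scale[OF A_linear[OF \<gamma>]])
  qed
  have bound: "norm x' \<le> K \<gamma> * norm x" if \<gamma>: "\<gamma> \<in> carrier G" and v: "?L v x" and v': "?L (\<lambda>n. A \<gamma> (v n)) x'" for \<gamma> v x x'
  proof -
    have "(\<lambda>n. B n (A \<gamma> (v n)) (A \<gamma> (v n))) \<longlonglongrightarrow> x' \<bullet> x'" by (rule lim[OF _ _ v' v'])
    moreover have "(\<lambda>n. (K \<gamma>)\<^sup>2 * B n (v n) (v n)) \<longlonglongrightarrow> (K \<gamma>)\<^sup>2 * (x \<bullet> x)"
      by (intro tendsto_mult tendsto_const lim[OF _ _ v v])
    ultimately have "x' \<bullet> x' \<le> (K \<gamma>)\<^sup>2 * (x \<bullet> x)"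
      by (rule LIMSEQ_le) (use B_A[OF \<gamma>] in blast)
    then have "(norm x')\<^sup>2 \<le> (K \<gamma> * norm x)\<^sup>2" by (simp add: power_mult_distrib power2_norm_eq_inner)
    then show ?thesis by (rule power2_le_imp_le) (simp add: K_nonneg[OF \<gamma>])
  qed
  have unique: "x' = x''" if \<gamma>: "\<gamma> \<in> carrier G" and v: "?L v x" "?L (\<lambda>n. A \<gamma> (v n)) x'"
    and w: "?L w x" "?L (\<lambda>n. A \<gamma> (w n)) x''" for \<gamma> v w x x' x''
  proof -
    have "?L (\<lambda>n. v n - w n) 0" using limit_pair_diff[OF v(1) w(1)] by simp
    moreover have "?L (\<lambda>n. A \<gamma> (v n - w n)) (x' - x'')"
      using limit_pair_diff[OF v(2) w(2)] by (simp add: linear_diff[OF A_linear[OF \<gamma>]])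
    ultimately have "norm (x' - x'') \<le> K \<gamma> * norm (0::'v)" by (rule bound[OF \<gamma>])
    then show ?thesis by simp
  qed
  obtain b where b: "b \<subseteq> y ` carrier G" "independent b" "y ` carrier G \<subseteq> span b"
    using maximal_independent_subset by blast
  then have span_b: "span b = span (y ` carrier G)"
    by (metis span_mono span_span subset_antisym)
  \<comment> \<open>\<open>T \<gamma>\<close> is chosen on a basis of the span and extended
    linearly; \<open>unique\<close> later shows that it gives the limit for every representing
    sequence.\<close>
  have "\<exists>T. linear T \<and> (\<forall>x\<in>span b. \<exists>v. ?L v x \<and> ?L (\<lambda>n. A \<gamma> (v n)) (T x))" if \<gamma>: "\<gamma> \<in> carrier G" for \<gamma>
  proof -
    have "\<exists>x' v. ?L v x \<and> ?L (\<lambda>n. A \<gamma> (v n)) x'" if "x \<in> b" for x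
    proof -
      from that b(1) obtain g where "g \<in> carrier G" "x = y g" by blast
      then show ?thesis using limit_pair.gen[of g "carrier G" z y] image[OF \<gamma>] by blast
    qed
    then obtain T0 where T0: "\<And>x. x \<in> b \<Longrightarrow> \<exists>v. ?L v x \<and> ?L (\<lambda>n. A \<gamma> (v n)) (T0 x)" by metis
    obtain T where T: "linear T" "\<forall>x\<in>b. T x = T0 x"
      using linear_independent_extend[OF b(2), of T0] by blast
    have "\<exists>v. ?L v x \<and> ?L (\<lambda>n. A \<gamma> (v n)) (T x)" if "x \<in> span b" for x
      using that
    proof (induction rule: span_induct_alt)
      case base
      have "?L (\<lambda>n. 0) 0 \<and> ?L (\<lambda>n. A \<gamma> 0) (T 0)"
        using limit_pair.zero by (simp add: linear_0[OF T(1)] linear_0[OF A_linear[OF \<gamma>]])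
      then show ?case by blast
    next
      case (step c x x')
      obtain v where v: "?L v x" "?L (\<lambda>n. A \<gamma> (v n)) (T x)" using T0[OF step(1)] T(2) step(1) by auto
      obtain w where w: "?L w x'" "?L (\<lambda>n. A \<gamma> (w n)) (T x')" using step(2) by blast
      have "?L (\<lambda>n. c *\<^sub>R v n + w n) (c *\<^sub>R x + x')"
        by (intro limit_pair.add limit_pair.scale v w)
      moreover have "?L (\<lambda>n. A \<gamma> (c *\<^sub>R v n + w n)) (T (c *\<^sub>R x + x'))"
        unfolding linear_add[OF A_linear[OF \<gamma>]] linear_scale[OF A_linear[OF \<gamma>]] linear_add[OF T(1)] linear_scale[OF T(1)]
        by (intro limit_pair.add limit_pair.scale v w)
      ultimately show ?case by blast
    qed
    then show ?thesis using T(1) by blast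
  qed
  then obtain T where T_lin: "\<And>\<gamma>. \<gamma> \<in> carrier G \<Longrightarrow> linear (T \<gamma>)"
    and T: "\<And>\<gamma> x. \<gamma> \<in> carrier G \<Longrightarrow> x \<in> span b \<Longrightarrow> \<exists>v. ?L v x \<and> ?L (\<lambda>n. A \<gamma> (v n)) (T \<gamma> x)"
    by metis
  have in_span: "x \<in> span b" if "?L v x" for v x
    using that by induction (auto simp: span_b intro: span_base span_zero span_add span_scale)
  have T_limit: "?L (\<lambda>n. A \<gamma> (v n)) (T \<gamma> x)" if \<gamma>: "\<gamma> \<in> carrier G" and v: "?L v x" for \<gamma> v x
  proof -
    obtain w where w: "?L w x" "?L (\<lambda>n. A \<gamma> (w n)) (T \<gamma> x)" using T[OF \<gamma> in_span[OF v]] by blast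
    obtain x' where x': "?L (\<lambda>n. A \<gamma> (v n)) x'" using image[OF \<gamma> v] by blast
    then show ?thesis using unique[OF \<gamma> v x' w] by simp
  qed
  have "bounded_cocycle G T y K"
  proof (intro bounded_cocycle.intro bounded_cocycle_axioms.intro is_group)
    show "T \<gamma> (y g) = y (\<gamma> \<otimes> g) - y \<gamma>" if "\<gamma> \<in> carrier G" "g \<in> carrier G" for \<gamma> g
    proof (rule unique[OF that(1)])
      show "?L (\<lambda>n. z n g) (y g)" "?L (\<lambda>n. z n g) (y g)" using that by (auto intro: limit_pair.gen)
      then show "?L (\<lambda>n. A \<gamma> (z n g)) (T \<gamma> (y g))" using T_limit[OF that(1)] by blast
      show "?L (\<lambda>n. A \<gamma> (z n g)) (y (\<gamma> \<otimes> g) - y \<gamma>)"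
        unfolding z_cocycle[OF that] using that by (intro limit_pair_diff limit_pair.gen) auto
    qed
    show "norm (T \<gamma> x) \<le> K \<gamma> * norm x" if "\<gamma> \<in> carrier G" "x \<in> span (y ` carrier G)" for \<gamma> x
      using T[of \<gamma> x] that bound[OF that(1)] span_b by blast
    show "y \<one> = 0"
      using conv[OF one_closed one_closed] by (simp add: z_one psd_form.zero_left[OF psd] LIMSEQ_const_iff)
  qed (use T_lin K_nonneg in auto)
  then show ?thesis using T_limit by blast
qed

section \<open>Harmonic cocycles from almost harmonic ones\<close>

text \<open>Contrapositive of \<open>fixed_point_of_gap\<close>: the gap must fail at some
  \<open>v\<close>, and \<open>z\<close> is the displacement cocycle of \<open>v\<close>, rescaled
  to energy 1 on \<open>S\<close>.\<close>

lemma (in conj_bounded_rep) almost_harmonic_cocycle: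
  assumes gen: "generate G S = carrier G" and S_sym: "\<forall>s\<in>S. inv s \<in> S"
    and act_one: "\<And>v. \<rho> \<one> v = v"
    and act_mult: "\<And>\<gamma> \<eta> v. \<gamma> \<in> carrier G \<Longrightarrow> \<eta> \<in> carrier G \<Longrightarrow> \<rho> (\<gamma> \<otimes> \<eta>) v = \<rho> \<gamma> (\<rho> \<eta> v)"
    and affine: "\<And>\<gamma> v. \<gamma> \<in> carrier G \<Longrightarrow> \<rho> \<gamma> v = A \<gamma> v + b \<gamma>"
    and no_fix: "\<not> (\<exists>v. \<forall>\<gamma>\<in>carrier G. \<rho> \<gamma> v = v)"
    and \<epsilon>: "0 < \<epsilon>" "\<epsilon> \<le> 1"
  defines "B \<equiv> mean_form (1 / (1 + \<epsilon> / 8))"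
  shows "\<exists>z. (\<forall>\<gamma>\<in>carrier G. \<forall>g\<in>carrier G. A \<gamma> (z g) = z (\<gamma> \<otimes> g) - z \<gamma>) \<and> z \<one> = 0 \<and>
    (\<Sum>s\<in>S. B (z s) (z s)) = 1 \<and>
    (\<forall>s\<in>S. B (A s (\<Sum>t\<in>S. z t) - (\<Sum>t\<in>S. z t)) (A s (\<Sum>t\<in>S. z t) - (\<Sum>t\<in>S. z t)) \<le> (real (card S))\<^sup>2 * \<epsilon>)"
proof -
  \<comment> \<open>This weight turns the factor \<open>1 / r\<close> of
    \<open>mean_form_average_le\<close> into \<open>1 + \<epsilon> / 8\<close>.\<close>
  define r where "r = 1 / (1 + \<epsilon> / 8)"
  have r: "0 < r" "r < 1" using \<epsilon> by (auto simp: r_def field_simps)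
  have B: "B = mean_form r" by (simp add: B_def r_def)
  interpret psd_form B unfolding B by (rule psd_mean_form[OF r])
  have linS: "linear (A s)" if "s \<in> S" for s using that S_sub by (auto intro: A_linear)
  have no_fix_S: "\<not> (\<exists>w. \<forall>s\<in>S. \<rho> s w = w)"
  proof
    assume "\<exists>w. \<forall>s\<in>S. \<rho> s w = w"
    then obtain w where w: "\<And>s. s \<in> S \<Longrightarrow> \<rho> s w = w" by blast
    have "\<rho> \<gamma> w = w" if "\<gamma> \<in> generate G S" for \<gamma>
      using that
    proof induction
      case (eng h1 h2)
      then show ?case using act_mult gen by simp
    qed (use w S_sym act_one in auto)
    then show False using no_fix gen by auto
  qed
  have cont: "continuous_on UNIV (\<rho> s)" if "s \<in> S" for s
  proof -
    have s: "s \<in> carrier G" using that S_sub by blast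
    have "bounded_linear (A s)"
      using A_bound[OF s] linear_add[OF linS[OF that]] linear_scale[OF linS[OF that]]
      by (intro bounded_linear_intro[where K = "K s"]) (auto simp: mult.commute)
    then have "continuous_on UNIV (\<lambda>v. A s v + b s)"
      by (rule continuous_on_add[OF linear_continuous_on continuous_on_const])
    moreover have "\<rho> s = (\<lambda>v. A s v + b s)" using affine[OF s] by blast
    ultimately show ?thesis by simp
  qed
  have avg: "(\<Sum>s\<in>S. B (A s v) (A s v)) \<le> card S * ((1 + \<epsilon> / 8) * B v v)" for v
    using mean_form_average_le[OF r, of v] unfolding B by (simp add: r_def mult.commute)
  have norm_le: "(norm v)\<^sup>2 \<le> B v v" for v
    unfolding B by (rule mean_form_ge[OF r])
  have "\<exists>v u. u = (\<Sum>s\<in>S. \<rho> s v - v) /\<^sub>R card S \<and>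
    (\<Sum>s\<in>S. B (A s u - u) (A s u - u)) < \<epsilon> * (\<Sum>s\<in>S. B (\<rho> s v - v) (\<rho> s v - v))"
  proof (rule ccontr)
    assume neg: "\<not> ?thesis"
    have "\<exists>w. \<forall>s\<in>S. \<rho> s w = w"
    proof (rule fixed_point_of_gap[OF psd_form_axioms S_fin S_ne linS _ cont norm_le avg \<epsilon>])
      show "\<rho> s v = A s v + b s" if "s \<in> S" for s v using that affine S_sub by blast
      show "\<epsilon> * (\<Sum>s\<in>S. B (\<rho> s v - v) (\<rho> s v - v)) \<le> (\<Sum>s\<in>S. B (A s u - u) (A s u - u))"
        if "u = (\<Sum>s\<in>S. \<rho> s v - v) /\<^sub>R card S" for v u
        using neg that not_le by blast
    qed
    then show False using no_fix_S by blast
  qed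
  then obtain v u where u: "u = (\<Sum>s\<in>S. \<rho> s v - v) /\<^sub>R card S"
    and less: "(\<Sum>s\<in>S. B (A s u - u) (A s u - u)) < \<epsilon> * (\<Sum>s\<in>S. B (\<rho> s v - v) (\<rho> s v - v))"
    by blast
  define E where "E = (\<Sum>s\<in>S. B (\<rho> s v - v) (\<rho> s v - v))"
  \<comment> \<open>The strict failure of the gap forces positive energy \<open>E\<close>, which
    permits the normalisation.\<close>
  have "0 \<le> (\<Sum>s\<in>S. B (A s u - u) (A s u - u))" by (intro sum_nonneg nonneg)
  then have "0 < \<epsilon> * E" using less by (simp add: E_def)
  then have E: "E > 0" using \<epsilon> by (simp add: zero_less_mult_iff)
  define c where "c = 1 / sqrt E"
  have c2: "c * (c * x) = x / E" for x
    using E by (simp add: c_def)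
  define z where "z g = c *\<^sub>R (\<rho> g v - v)" for g
  have "A \<gamma> (z g) = z (\<gamma> \<otimes> g) - z \<gamma>" if "\<gamma> \<in> carrier G" "g \<in> carrier G" for \<gamma> g
  proof -
    have "A \<gamma> (\<rho> g v - v) = \<rho> \<gamma> (\<rho> g v) - \<rho> \<gamma> v"
      using that by (simp add: affine[OF that(1)] linear_diff[OF A_linear])
    also have "\<dots> = (\<rho> (\<gamma> \<otimes> g) v - v) - (\<rho> \<gamma> v - v)" using that by (simp add: act_mult)
    finally show ?thesis
      unfolding z_def linear_scale[OF A_linear[OF that(1)]] scaleR_diff_right[symmetric] by simp
  qed
  moreover have "z \<one> = 0" by (simp add: z_def act_one)
  moreover have "(\<Sum>s\<in>S. B (z s) (z s)) = 1"
    using E by (simp add: z_def scale_left scale_right c2 sum_divide_distrib[symmetric] E_def[symmetric])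
  moreover have "B (A s (\<Sum>t\<in>S. z t) - (\<Sum>t\<in>S. z t)) (A s (\<Sum>t\<in>S. z t) - (\<Sum>t\<in>S. z t)) \<le> (real (card S))\<^sup>2 * \<epsilon>"
    if s: "s \<in> S" for s
  proof -
    \<comment> \<open>\<open>u\<close> is a mean and this is a sum; hence the square of
      \<open>card S\<close> in the estimate.\<close>
    have "(\<Sum>t\<in>S. z t) = c *\<^sub>R (\<Sum>t\<in>S. \<rho> t v - v)" by (simp only: z_def scaleR_sum_right)
    also have "\<dots> = (c * card S) *\<^sub>R u" using card_S_pos by (simp add: u)
    finally have "A s (\<Sum>t\<in>S. z t) - (\<Sum>t\<in>S. z t) = (c * card S) *\<^sub>R (A s u - u)"
      by (simp add: linear_scale[OF linS[OF s]] scaleR_diff_right)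
    then have "B (A s (\<Sum>t\<in>S. z t) - (\<Sum>t\<in>S. z t)) (A s (\<Sum>t\<in>S. z t) - (\<Sum>t\<in>S. z t)) =
        (real (card S))\<^sup>2 * (c * (c * B (A s u - u) (A s u - u)))"
      by (simp only: scale_left scale_right power2_eq_square mult_ac)
    also have "\<dots> \<le> (real (card S))\<^sup>2 * \<epsilon>"
    proof (rule mult_left_mono)
      have "B (A s u - u) (A s u - u) \<le> (\<Sum>s\<in>S. B (A s u - u) (A s u - u))"
        using S_fin s by (intro member_le_sum nonneg) auto
      also have "\<dots> \<le> \<epsilon> * E" using less by (simp add: E_def)
      finally show "c * (c * B (A s u - u) (A s u - u)) \<le> \<epsilon>"
        unfolding c2 using E by (simp add: field_simps)
    qed simp
    finally show ?thesis .
  qed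
  ultimately show ?thesis by blast
qed

section \<open>Polynomial growth and conjugacy length\<close>

lemma summable_poly_geometric:
  fixes r :: real
  assumes r: "0 < r" "r < 1"
  shows "summable (\<lambda>k. r ^ k * (a * real (Suc k) ^ m)\<^sup>2)"
proof -
  let ?f = "\<lambda>k. real (Suc k) ^ (2 * m) * r ^ k"
  have "(\<lambda>k. (1 + inverse (real (Suc k))) ^ (2 * m) * r) \<longlonglongrightarrow> (1 + 0) ^ (2 * m) * r"
    by (intro tendsto_intros LIMSEQ_inverse_real_of_nat)
  \<comment> \<open>\<open>(1 + r) / 2\<close> lies strictly between the limit \<open>r\<close> of
    the quotients and 1.\<close>
  moreover have "(1 + 0) ^ (2 * m) * r < (1 + r) / 2" using r by simp
  ultimately have "eventually (\<lambda>k. (1 + inverse (real (Suc k))) ^ (2 * m) * r < (1 + r) / 2) sequentially"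
    by (rule order_tendstoD)
  then obtain N where N: "\<And>k. k \<ge> N \<Longrightarrow> (1 + inverse (real (Suc k))) ^ (2 * m) * r < (1 + r) / 2"
    by (auto simp: eventually_sequentially)
  have "summable ?f"
  proof (rule summable_ratio_test)
    show "(1 + r) / 2 < 1" using r by simp
    fix k assume "k \<ge> N"
    have e: "real (Suc (Suc k)) = real (Suc k) * (1 + inverse (real (Suc k)))" by (simp add: field_simps)
    have "?f (Suc k) = ?f k * ((1 + inverse (real (Suc k))) ^ (2 * m) * r)"
      unfolding e power_mult_distrib by simp
    also have "\<dots> \<le> ?f k * ((1 + r) / 2)"
      using N[OF \<open>k \<ge> N\<close>] r by (intro mult_left_mono) auto
    finally have "?f (Suc k) \<le> (1 + r) / 2 * ?f k" by (simp only: mult.commute)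
    moreover have "0 \<le> ?f i" for i using r by simp
    ultimately show "norm (?f (Suc k)) \<le> (1 + r) / 2 * norm (?f k)" by (simp only: real_norm_def abs_of_nonneg)
  qed
  then have "summable (\<lambda>k. a\<^sup>2 * ?f k)" by (rule summable_mult)
  then show ?thesis by (simp add: power_mult_distrib power_mult[symmetric] mult_ac)
qed

text \<open>Multiplying the conjugator by \<open>x\<close> or \<open>inv x\<close> shows that both
  minima range over the same lengths.\<close>

lemma (in group) conj_length_conj:
  assumes "g \<in> carrier G" "x \<in> carrier G"
  shows "conj_length G S (x \<otimes> g \<otimes> inv x) = conj_length G S g"
proof -
  have "(\<exists>h\<in>carrier G. word_length G S (h \<otimes> (x \<otimes> g \<otimes> inv x) \<otimes> inv h) = n) \<longleftrightarrow>
      (\<exists>h\<in>carrier G. word_length G S (h \<otimes> g \<otimes> inv h) = n)" for n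
  proof
    assume "\<exists>h\<in>carrier G. word_length G S (h \<otimes> (x \<otimes> g \<otimes> inv x) \<otimes> inv h) = n"
    then obtain h where "h \<in> carrier G" "word_length G S (h \<otimes> (x \<otimes> g \<otimes> inv x) \<otimes> inv h) = n" by blast
    moreover have "h \<otimes> (x \<otimes> g \<otimes> inv x) \<otimes> inv h = (h \<otimes> x) \<otimes> g \<otimes> inv (h \<otimes> x)"
      using assms \<open>h \<in> carrier G\<close> by (simp add: m_assoc inv_mult_group)
    ultimately show "\<exists>h\<in>carrier G. word_length G S (h \<otimes> g \<otimes> inv h) = n" using assms m_closed by metis
  next
    assume "\<exists>h\<in>carrier G. word_length G S (h \<otimes> g \<otimes> inv h) = n"
    then obtain h where h: "h \<in> carrier G" "word_length G S (h \<otimes> g \<otimes> inv h) = n" by blast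
    have "(h \<otimes> inv x) \<otimes> (x \<otimes> g \<otimes> inv x) \<otimes> inv (h \<otimes> inv x) = h \<otimes> g \<otimes> inv h"
    proof -
      have "inv x \<otimes> (x \<otimes> w) = w" if "w \<in> carrier G" for w
        using that assms by (simp add: m_assoc[symmetric])
      then show ?thesis using assms h(1) by (simp add: m_assoc inv_mult_group)
    qed
    then show "\<exists>h\<in>carrier G. word_length G S (h \<otimes> (x \<otimes> g \<otimes> inv x) \<otimes> inv h) = n"
      using assms h by (intro bexI[of _ "h \<otimes> inv x"]) auto
  qed
  then show ?thesis by (simp add: conj_length_def)
qed

lemma (in group) conj_length_word_le:
  assumes "set ws \<subseteq> S" "S \<subseteq> carrier G"
  shows "conj_length G S (foldr (\<otimes>) ws \<one>) \<le> length ws"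
proof -
  let ?g = "foldr (\<otimes>) ws \<one>"
  have g: "?g \<in> carrier G" using assms by (induction ws) auto
  have "conj_length G S ?g \<le> word_length G S ?g"
    unfolding conj_length_def by (rule Least_le) (use g in \<open>auto intro!: bexI[of _ \<one>]\<close>)
  also have "\<dots> \<le> length ws"
    unfolding word_length_def by (rule Least_le) (use assms in blast)
  finally show ?thesis .
qed

section \<open>Passage to the limit and the harmonic map\<close>

theorem mainTheorem2:
  fixes G :: "('g, 'm) monoid_scheme" (structure)
    and S :: "'g set"
    and \<rho> :: "'g \<Rightarrow> 'h::{real_inner, complete_space} \<Rightarrow> 'h"
    and A :: "'g \<Rightarrow> 'h \<Rightarrow> 'h"
    and b :: "'g \<Rightarrow> 'h"
    and C \<sigma> :: real
  assumes grp: "group G"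
    and S_fin: "finite S" and S_sub: "S \<subseteq> carrier G"
    and S_sym: "\<forall>s\<in>S. inv s \<in> S"
    and S_gen: "generate G S = carrier G"
    and act_one: "\<forall>v. \<rho> \<one> v = v"
    and act_mult: "\<forall>\<gamma>\<in>carrier G. \<forall>\<eta>\<in>carrier G. \<forall>v. \<rho> (\<gamma> \<otimes> \<eta>) v = \<rho> \<gamma> (\<rho> \<eta> v)"
    and affine: "\<forall>\<gamma>\<in>carrier G. \<forall>v. \<rho> \<gamma> v = A \<gamma> v + b \<gamma>"
    and A_lin: "\<forall>\<gamma>\<in>carrier G. bounded_linear (A \<gamma>)"
    and C_pos: "C > 0" and \<sigma>_nonneg: "\<sigma> \<ge> 0"
    and A_bound: "\<forall>\<gamma>\<in>carrier G. \<gamma> \<noteq> \<one> \<longrightarrow>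
                    onorm (A \<gamma>) \<le> C * real (conj_length G S \<gamma>) powr \<sigma>"
    and no_fix: "\<not> (\<exists>v. \<forall>\<gamma>\<in>carrier G. \<rho> \<gamma> v = v)"
  shows "\<exists>(\<rho>' :: 'g \<Rightarrow> (nat \<Rightarrow> real) \<Rightarrow> (nat \<Rightarrow> real)) A' b' (f :: 'g \<Rightarrow> nat \<Rightarrow> real).
           (\<forall>\<gamma>\<in>carrier G. l2_linear (A' \<gamma>) \<and> l2_bounded (A' \<gamma>) \<and> b' \<gamma> \<in> l2)
         \<and> (\<forall>\<gamma>\<in>carrier G. \<forall>v\<in>l2. \<rho>' \<gamma> v = (\<lambda>n. A' \<gamma> v n + b' \<gamma> n))
         \<and> (\<forall>v\<in>l2. \<rho>' \<one> v = v)
         \<and> (\<forall>\<gamma>\<in>carrier G. \<forall>\<eta>\<in>carrier G. \<forall>v\<in>l2. \<rho>' (\<gamma> \<otimes> \<eta>) v = \<rho>' \<gamma> (\<rho>' \<eta> v))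
         \<and> (\<forall>\<gamma>\<in>carrier G. \<gamma> \<noteq> \<one> \<longrightarrow>
               l2_opnorm (A' \<gamma>) \<le> C * real (conj_length G S \<gamma>) powr \<sigma>)
         \<and> (\<forall>x\<in>carrier G. f x \<in> l2)
         \<and> (\<forall>\<gamma>\<in>carrier G. \<forall>x\<in>carrier G. f (\<gamma> \<otimes> x) = \<rho>' \<gamma> (f x))
         \<and> (\<forall>x\<in>carrier G. (\<lambda>n. (\<Sum>s\<in>S. f (x \<otimes> s) n) / real (card S)) = f x)
         \<and> (\<exists>x\<in>carrier G. \<exists>y\<in>carrier G. f x \<noteq> f y)"
proof -
  interpret group G by (rule grp)
  \<comment> \<open>An empty \<open>S\<close> would generate the trivial group, which fixes every
    point.\<close>
  have S_ne: "S \<noteq> {}"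
  proof
    assume "S = {}"
    then have "carrier G = {\<one>}" using S_gen generate_empty by simp
    then show False using no_fix act_one by simp
  qed
  have A_linear: "linear (A \<gamma>)" if "\<gamma> \<in> carrier G" for \<gamma>
    using that A_lin bounded_linear.linear by blast
  have b_one: "b \<one> = 0"
    using affine act_one linear_0[OF A_linear[OF one_closed]] one_closed by (metis add_0)
  have A_one: "A \<one> v = v" for v
    using affine act_one b_one one_closed by (metis add.right_neutral)
  have A_mult: "A (\<gamma> \<otimes> \<eta>) v = A \<gamma> (A \<eta> v)" if "\<gamma> \<in> carrier G" "\<eta> \<in> carrier G" for \<gamma> \<eta> v
  proof -
    have *: "A (\<gamma> \<otimes> \<eta>) v + b (\<gamma> \<otimes> \<eta>) = A \<gamma> (A \<eta> v) + A \<gamma> (b \<eta>) + b \<gamma>" for v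
      using that affine act_mult linear_add[OF A_linear[OF that(1)]] by (metis m_closed)
    from *[of 0] have "b (\<gamma> \<otimes> \<eta>) = A \<gamma> (b \<eta>) + b \<gamma>"
      using that by (simp add: linear_0[OF A_linear])
    then show ?thesis using *[of v] by (simp add: add.assoc)
  qed
  \<comment> \<open>At the identity the formula gives 0, as \<open>conj_length\<close> vanishes
    there and \<open>0 powr \<sigma> = 0\<close> even for \<open>\<sigma> = 0\<close>; the value 1
    takes its place.\<close>
  define K where "K \<gamma> = (if \<gamma> = \<one> then 1 else C * real (conj_length G S \<gamma>) powr \<sigma>)" for \<gamma>
  have K_nonneg: "0 \<le> K \<gamma>" for \<gamma> using C_pos by (simp add: K_def)
  \<comment> \<open>A natural exponent at least \<open>\<sigma>\<close> gives a polynomial bound: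
    the base \<open>Suc k\<close> is at least 1, and \<open>1 + C\<close> covers both cases of
    \<open>K\<close>.\<close>
  define m where "m = nat \<lceil>\<sigma>\<rceil>"
  define c where "c k = (1 + C) * real (Suc k) ^ m" for k
  interpret conj_bounded_rep G S A K c
  proof (intro conj_bounded_rep.intro conj_bounded_rep_axioms.intro is_group)
    show "norm (A \<gamma> v) \<le> K \<gamma> * norm v" if "\<gamma> \<in> carrier G" for \<gamma> v
    proof (cases "\<gamma> = \<one>")
      case False
      have "norm (A \<gamma> v) \<le> onorm (A \<gamma>) * norm v" using A_lin that by (intro onorm) auto
      also have "\<dots> \<le> K \<gamma> * norm v" using A_bound that False by (intro mult_right_mono) (auto simp: K_def)
      finally show ?thesis .
    qed (simp add: A_one K_def)
    show "K (h \<otimes> \<gamma> \<otimes> inv h) = K \<gamma>" if "\<gamma> \<in> carrier G" "h \<in> carrier G" for \<gamma> h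
    proof -
      have "h \<otimes> \<gamma> \<otimes> inv h = \<one> \<longleftrightarrow> \<gamma> = \<one>"
        using that by (metis inv_closed inv_solve_right l_cancel_one' m_closed one_closed r_cancel_one' r_inv r_one inv_equality l_one)
      then show ?thesis using that by (simp add: K_def conj_length_conj)
    qed
    show "K (foldr (\<otimes>) ws \<one>) \<le> c (length ws)" if "set ws \<subseteq> S" for ws
    proof -
      let ?g = "foldr (\<otimes>) ws \<one>"
      have "real (conj_length G S ?g) powr \<sigma> \<le> real (Suc (length ws)) powr \<sigma>"
        using conj_length_word_le[OF that S_sub] \<sigma>_nonneg by (intro powr_mono2) auto
      also have "\<dots> \<le> real (Suc (length ws)) powr real m"
        unfolding m_def by (intro powr_mono) (use real_nat_ceiling_ge in auto)
      also have "\<dots> = real (Suc (length ws)) ^ m" by (rule powr_realpow) simp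
      finally have "C * real (conj_length G S ?g) powr \<sigma> \<le> C * real (Suc (length ws)) ^ m"
        using C_pos by (intro mult_left_mono) auto
      moreover have one: "1 \<le> real (Suc (length ws)) ^ m" by (rule one_le_power) simp
      moreover have "0 \<le> C * real (Suc (length ws)) ^ m" using C_pos by simp
      moreover have "c (length ws) = real (Suc (length ws)) ^ m + C * real (Suc (length ws)) ^ m"
        by (simp only: c_def distrib_right mult_1)
      ultimately show ?thesis unfolding K_def by (split if_split) linarith
    qed
    show "summable (\<lambda>k. r ^ k * (c k)\<^sup>2)" if "0 < r" "r < 1" for r
      unfolding c_def using that by (rule summable_poly_geometric)
  qed (use S_fin S_ne S_sub A_linear A_one A_mult in auto)
  \<comment> \<open>The errors tend to 0, so the weights \<open>1 / (1 + \<epsilon> n / 8)\<close>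
    tend to 1.\<close>
  define \<epsilon> where "\<epsilon> n = inverse (real (Suc n))" for n
  have \<epsilon>: "0 < \<epsilon> n" "\<epsilon> n \<le> 1" for n by (auto simp: \<epsilon>_def field_simps)
  define B where "B n = mean_form (1 / (1 + \<epsilon> n / 8))" for n
  have r: "0 < 1 / (1 + \<epsilon> n / 8)" "1 / (1 + \<epsilon> n / 8) < 1" for n
    using \<epsilon>[of n] by (auto simp: field_simps)
  have psd: "psd_form (B n)" for n unfolding B_def by (rule psd_mean_form[OF r])
  have B_A: "B n (A \<gamma> v) (A \<gamma> v) \<le> (K \<gamma>)\<^sup>2 * B n v v" if "\<gamma> \<in> carrier G" for n \<gamma> v
    unfolding B_def by (rule mean_form_A_le[OF r that])
  let ?d = "\<lambda>n z s. B n (A s (\<Sum>t\<in>S. z t) - (\<Sum>t\<in>S. z t)) (A s (\<Sum>t\<in>S. z t) - (\<Sum>t\<in>S. z t))"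
  have "\<exists>z. (\<forall>\<gamma>\<in>carrier G. \<forall>g\<in>carrier G. A \<gamma> (z g) = z (\<gamma> \<otimes> g) - z \<gamma>) \<and> z \<one> = 0 \<and>
    (\<Sum>s\<in>S. B n (z s) (z s)) = 1 \<and> (\<forall>s\<in>S. ?d n z s \<le> (real (card S))\<^sup>2 * \<epsilon> n)" for n
    unfolding B_def
    by (rule almost_harmonic_cocycle[OF S_gen S_sym, of \<rho> b]) (use act_one act_mult affine no_fix \<epsilon> in auto)
  from choice[OF allI[OF this]] obtain z where
    z: "\<forall>n. (\<forall>\<gamma>\<in>carrier G. \<forall>g\<in>carrier G. A \<gamma> (z n g) = z n (\<gamma> \<otimes> g) - z n \<gamma>) \<and> z n \<one> = 0 \<and>
      (\<Sum>s\<in>S. B n (z n s) (z n s)) = 1 \<and> (\<forall>s\<in>S. ?d n (z n) s \<le> (real (card S))\<^sup>2 * \<epsilon> n)" ..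
  have z_cocycle: "A \<gamma> (z n g) = z n (\<gamma> \<otimes> g) - z n \<gamma>" if "\<gamma> \<in> carrier G" "g \<in> carrier G" for n \<gamma> g
    using z that by blast
  have z_one: "z n \<one> = 0" and z_energy: "(\<Sum>s\<in>S. B n (z n s) (z n s)) = 1" for n
    using z by blast+
  have z_harmonic: "?d n (z n) s \<le> (real (card S))\<^sup>2 * \<epsilon> n" if "s \<in> S" for n s
    using z that by blast
  \<comment> \<open>Unit energy bounds the generators by 1. The cocycle identity,
    \<open>add_le\<close> and \<open>B_A\<close> spread this to products, with constants independent
    of \<open>n\<close> because \<open>K\<close> serves all the forms.\<close>
  have bdd: "\<forall>g\<in>carrier G. \<exists>D. \<forall>n. B n (z n g) (z n g) \<le> D"
  proof
    fix g assume g: "g \<in> carrier G"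
    have base: "\<forall>n. B n (z n s) (z n s) \<le> 1" if "s \<in> S" for s
    proof
      fix n
      have "B n (z n s) (z n s) \<le> (\<Sum>s\<in>S. B n (z n s) (z n s))"
        using that S_fin by (intro member_le_sum psd_form.nonneg[OF psd]) auto
      then show "B n (z n s) (z n s) \<le> 1" using z_energy by simp
    qed
    have "g \<in> generate G S" using g S_gen by simp
    then show "\<exists>D. \<forall>n. B n (z n g) (z n g) \<le> D"
    proof induction
      case one
      show ?case by (auto simp: z_one psd_form.zero_left[OF psd])
    next
      case (incl h)
      then show ?case using base by blast
    next
      case (inv h)
      then show ?case using base S_sym by blast
    next
      case (eng h1 h2)
      then obtain D1 D2 where D1: "\<And>n. B n (z n h1) (z n h1) \<le> D1" and D2: "\<And>n. B n (z n h2) (z n h2) \<le> D2"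
        by blast
      have h: "h1 \<in> carrier G" "h2 \<in> carrier G" using eng S_gen by auto
      have "B n (z n (h1 \<otimes> h2)) (z n (h1 \<otimes> h2)) \<le> 2 * ((K h1)\<^sup>2 * D2) + 2 * D1" for n
      proof -
        have "z n (h1 \<otimes> h2) = A h1 (z n h2) + z n h1" using h by (simp add: z_cocycle)
        then have "B n (z n (h1 \<otimes> h2)) (z n (h1 \<otimes> h2)) \<le>
            2 * B n (A h1 (z n h2)) (A h1 (z n h2)) + 2 * B n (z n h1) (z n h1)"
          using psd_form.add_le[OF psd] by simp
        moreover have "B n (A h1 (z n h2)) (A h1 (z n h2)) \<le> (K h1)\<^sup>2 * D2"
          using B_A[OF h(1), of n "z n h2"] mult_left_mono[OF D2[of n], of "(K h1)\<^sup>2"] by simp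
        ultimately show ?thesis using D1[of n] by linarith
      qed
      then show ?case by blast
    qed
  qed
  have cnt: "countable (carrier G)"
    using countable_generate[OF S_fin S_sub S_sym] S_gen by simp
  obtain r and y :: "'g \<Rightarrow> ell2" where r_mono: "strict_mono (r :: nat \<Rightarrow> nat)"
    and conv': "\<forall>g\<in>carrier G. \<forall>h\<in>carrier G.
      (\<lambda>n. B (r n) (z (r n) g) (z (r n) h)) \<longlonglongrightarrow> y g \<bullet> y h"
    using gram_matrix_limit[where B = B and z = z, OF psd cnt bdd] by (elim exE conjE) (rule that)
  note conv = conv'[rule_format]
  have "\<exists>T. bounded_cocycle G T y K \<and> (\<forall>\<gamma>\<in>carrier G. \<forall>v x. limit_pair (\<lambda>n. z (r n)) y (carrier G) v x \<longrightarrow>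
    limit_pair (\<lambda>n. z (r n)) y (carrier G) (\<lambda>n. A \<gamma> (v n)) (T \<gamma> x))"
    by (rule limit_cocycle[where B = "\<lambda>n. B (r n)"]) (use psd conv A_linear z_cocycle z_one B_A K_nonneg in auto)
  then obtain T where coc: "bounded_cocycle G T y K"
    and T: "\<And>\<gamma> v x. \<gamma> \<in> carrier G \<Longrightarrow> limit_pair (\<lambda>n. z (r n)) y (carrier G) v x \<Longrightarrow>
      limit_pair (\<lambda>n. z (r n)) y (carrier G) (\<lambda>n. A \<gamma> (v n)) (T \<gamma> x)"
    by blast
  \<comment> \<open>The sums of \<open>z n\<close> over \<open>S\<close> are invariant up to a
    squared error proportional to \<open>\<epsilon> n\<close>, so the limit of the sums is exactly
    invariant.\<close>
  have T_inv: "T s (\<Sum>t\<in>S. y t) = (\<Sum>t\<in>S. y t)" if s: "s \<in> S" for s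
  proof -
    let ?u = "\<Sum>t\<in>S. y t"
    have "limit_pair (\<lambda>n. z (r n)) y (carrier G) (\<lambda>n. \<Sum>t\<in>S. z (r n) t) ?u"
      using S_sub by (intro limit_pair_sum limit_pair.gen) auto
    then have lp: "limit_pair (\<lambda>n. z (r n)) y (carrier G)
        (\<lambda>n. A s (\<Sum>t\<in>S. z (r n) t) - (\<Sum>t\<in>S. z (r n) t)) (T s ?u - ?u)"
      using T[of s] s S_sub by (intro limit_pair_diff) auto
    have lim: "(\<lambda>n. ?d (r n) (z (r n)) s) \<longlonglongrightarrow> (T s ?u - ?u) \<bullet> (T s ?u - ?u)"
      by (rule limit_pair_tendsto[OF _ _ lp lp, where B = "\<lambda>n. B (r n)"]) (use psd conv in auto)
    have "(\<lambda>n. (real (card S))\<^sup>2 * \<epsilon> n) \<longlonglongrightarrow> (real (card S))\<^sup>2 * 0"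
      unfolding \<epsilon>_def by (intro tendsto_mult tendsto_const LIMSEQ_inverse_real_of_nat)
    then have "(\<lambda>n. (real (card S))\<^sup>2 * \<epsilon> (r n)) \<longlonglongrightarrow> (real (card S))\<^sup>2 * 0"
      using LIMSEQ_subseq_LIMSEQ[OF _ r_mono] by (auto simp: o_def)
    then have "(T s ?u - ?u) \<bullet> (T s ?u - ?u) \<le> (real (card S))\<^sup>2 * 0"
      by (rule LIMSEQ_le[OF lim]) (use z_harmonic[OF s] in blast)
    then have "(norm (T s ?u - ?u))\<^sup>2 \<le> 0" by (simp add: power2_norm_eq_inner)
    then show ?thesis by simp
  qed
  \<comment> \<open>The energy on \<open>S\<close> is 1 for every \<open>n\<close>, hence also in
    the limit.\<close>
  have "\<exists>s\<in>S. y s \<noteq> 0"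
  proof (rule ccontr)
    assume "\<not> ?thesis"
    then have y0: "y s = 0" if "s \<in> S" for s using that by blast
    have "(\<lambda>n. \<Sum>s\<in>S. B (r n) (z (r n) s) (z (r n) s)) \<longlonglongrightarrow> (\<Sum>s\<in>S. y s \<bullet> y s)"
      using S_sub by (intro tendsto_sum conv) auto
    then show False using y0 by (simp add: z_energy LIMSEQ_const_iff)
  qed
  then obtain T' y' where coc': "bounded_cocycle G T' (y' :: 'g \<Rightarrow> ell2) K"
    and y': "(\<Sum>s\<in>S. y' s) = 0" "\<exists>g\<in>carrier G. y' g \<noteq> 0"
    using bounded_cocycle.project_invariant_sum[OF coc S_fin S_sub S_sym S_gen T_inv] by blast
  \<comment> \<open>Away from the identity \<open>K\<close> is the given bound, so \<open>C\<close>
    and \<open>\<sigma>\<close> are unchanged.\<close>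
  have K_eq: "l \<le> K \<gamma> \<Longrightarrow> \<gamma> \<noteq> \<one> \<longrightarrow> l \<le> C * real (conj_length G S \<gamma>) powr \<sigma>" for l \<gamma>
    by (auto simp: K_def)
  from bounded_cocycle.harmonic_l2_action[OF coc' S_ne S_fin S_sub cnt y'(2,1)]
  show ?thesis
    by (elim ex_forward conj_forward) (assumption | rule ballI K_eq | erule (1) bspec)+
qed

end
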